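(* For every $k\ge 1$ there is a polynomial-time algorithm that, given a pair of finite relational structures $\mathbf{A},\mathbf{B}$ over the same signature, decides whether or not there is a winning strategy for the Duplicator in the existential $k$-cover game on $\mathbf{A},\mathbf{B}$.
   Context: A relational structure $\mathbf{A}$ has a finite universe $A$ and relations $R^{\mathbf{A}}\subseteq A^r$ for each relation symbol $R$ (arity $r$) of a finite signature. The hypergraph $H(\mathbf{A})$ has vertex set $A$ and a hyperedge $\{a_1,\ldots,a_r\}$ for each tuple in any relation of $\mathbf{A}$. A $k$-union is a union of $k$ hyperedges (the empty set is the $0$-union); the weight of $X\subseteq A$ is the least $k\ge0$ such that $X\cap\bigcup_e e$ lies in a $k$-union. A projective homomorphism from $\mathbf{A}$ to $\mathbf{B}$ is a partial function $h$ from $A$ to $B$ such that for every $R$ and every $(a_1,\ldots,a_r)\in R^{\mathbf{A}}$ there exists $(b_1,\ldots,b_r)\in R^{\mathbf{B}}$ with $h(a_i)=b_i$ for all $a_i\in\mathsf{dom}(h)$. A winning strategy for the Duplicator in the existential $k$-cover game on $\mathbf{A},\mathbf{B}$ is a non-empty set $H$ of projective homomorphisms from $\mathbf{A}$ to $\mathbf{B}$, closed under subfunctions, such that for every $h\in H$ and every $a\in A\setminus\mathsf{dom}(h)$ with $\mathsf{dom}(h)\cup\{a\}$ of weight $\le k$, some $h'\in H$ extends $h$ with $\mathsf{dom}(h')=\mathsf{dom}(h)\cup\{a\}$. *)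

theory Defs
  imports "HOL-Computational_Algebra.Polynomial"
begin

section \<open>Relational structures and the existential cover game\<close>

record 's signature =
  symbols :: "'s set"
  arity :: "'s \<Rightarrow> nat"

text \<open>The value of \<open>rel\<close> at a non-symbol is irrelevant: everything below, including the input
  encoding, consults \<open>rel\<close> only at members of \<open>symbols \<sigma>\<close>.\<close>

record ('s, 'a) rel_structure =
  universe :: "'a set"
  rel :: "'s \<Rightarrow> 'a list set"

definition finite_structure :: "'s signature \<Rightarrow> ('s, 'a) rel_structure \<Rightarrow> bool" where
  "finite_structure \<sigma> A \<longleftrightarrow>
     finite (symbols \<sigma>) \<and> finite (universe A) \<and>
     (\<forall>R\<in>symbols \<sigma>. \<forall>t\<in>rel A R. length t = arity \<sigma> R \<and> set t \<subseteq> universe A)"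

definition hyperedges :: "'s signature \<Rightarrow> ('s, 'a) rel_structure \<Rightarrow> 'a set set" where
  "hyperedges \<sigma> A = {set t | R t. R \<in> symbols \<sigma> \<and> t \<in> rel A R}"

definition is_union_of :: "'s signature \<Rightarrow> ('s, 'a) rel_structure \<Rightarrow> nat \<Rightarrow> 'a set \<Rightarrow> bool" where
  "is_union_of \<sigma> A k U \<longleftrightarrow> (\<exists>F \<subseteq> hyperedges \<sigma> A. finite F \<and> card F = k \<and> U = \<Union>F)"

definition weight :: "'s signature \<Rightarrow> ('s, 'a) rel_structure \<Rightarrow> 'a set \<Rightarrow> nat" where
  "weight \<sigma> A X = (LEAST k. \<exists>U. is_union_of \<sigma> A k U \<and> X \<inter> \<Union>(hyperedges \<sigma> A) \<subseteq> U)"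

definition projective_hom ::
  "'s signature \<Rightarrow> ('s, 'a) rel_structure \<Rightarrow> ('s, 'b) rel_structure \<Rightarrow> ('a \<rightharpoonup> 'b) \<Rightarrow> bool" where
  "projective_hom \<sigma> A B h \<longleftrightarrow>
     dom h \<subseteq> universe A \<and> ran h \<subseteq> universe B \<and>
     (\<forall>R\<in>symbols \<sigma>. \<forall>as\<in>rel A R. \<exists>bs\<in>rel B R.
        \<forall>i<arity \<sigma> R. as ! i \<in> dom h \<longrightarrow> h (as ! i) = Some (bs ! i))"

definition winning_strategy ::
  "nat \<Rightarrow> 's signature \<Rightarrow> ('s, 'a) rel_structure \<Rightarrow> ('s, 'b) rel_structure \<Rightarrow> ('a \<rightharpoonup> 'b) set \<Rightarrow> bool" where
  "winning_strategy k \<sigma> A B H \<longleftrightarrow>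
     H \<noteq> {} \<and>
     (\<forall>h\<in>H. projective_hom \<sigma> A B h) \<and>
     (\<forall>h\<in>H. \<forall>g. g \<subseteq>\<^sub>m h \<longrightarrow> g \<in> H) \<and>
     (\<forall>h\<in>H. \<forall>a\<in>universe A - dom h. weight \<sigma> A (dom h \<union> {a}) \<le> k \<longrightarrow>
        (\<exists>h'\<in>H. h \<subseteq>\<^sub>m h' \<and> dom h' = dom h \<union> {a}))"


section \<open>Deterministic multitape Turing machines\<close>

datatype move = Go_Left | Stay | Go_Right

text \<open>States and tape symbols are initial segments of the naturals, \<open>0\<close> being the blank. Tapes are
  infinite in both directions. The transition function maps a state and the list of scanned
  symbols, one per tape, to a state and one write-and-move action per tape.\<close>

record tm =
  num_tapes :: nat
  num_states :: nat
  num_symbols :: nat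
  start :: nat
  accept :: nat
  reject :: nat
  delta :: "nat \<Rightarrow> nat list \<Rightarrow> nat \<times> (nat \<times> move) list"

definition wf_tm :: "tm \<Rightarrow> bool" where
  "wf_tm M \<longleftrightarrow>
     num_tapes M \<ge> 1 \<and> num_symbols M \<ge> 1 \<and>
     start M < num_states M \<and> accept M < num_states M \<and> reject M < num_states M \<and>
     accept M \<noteq> reject M \<and>
     (\<forall>q xs. q < num_states M \<and> length xs = num_tapes M \<and> set xs \<subseteq> {..<num_symbols M} \<longrightarrow>
        (case delta M q xs of (q', acts) \<Rightarrow>
           q' < num_states M \<and> length acts = num_tapes M \<and>
           fst ` set acts \<subseteq> {..<num_symbols M}))"

text \<open>A tape is a head position together with the cell contents.\<close>

type_synonym tape = "int \<times> (int \<Rightarrow> nat)"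
type_synonym config = "nat \<times> tape list"

fun scan :: "tape \<Rightarrow> nat" where
  "scan (p, c) = c p"

fun act :: "nat \<times> move \<Rightarrow> tape \<Rightarrow> tape" where
  "act (s, m) (p, c) =
     (case m of Go_Left \<Rightarrow> p - 1 | Stay \<Rightarrow> p | Go_Right \<Rightarrow> p + 1, c(p := s))"

fun step :: "tm \<Rightarrow> config \<Rightarrow> config" where
  "step M (q, ts) =
     (if q = accept M \<or> q = reject M then (q, ts)
      else case delta M q (map scan ts) of (q', acts) \<Rightarrow> (q', map2 act acts ts))"

definition blank_tape :: tape where
  "blank_tape = (0, \<lambda>_. 0)"

definition input_tape :: "nat list \<Rightarrow> tape" where
  "input_tape w = (0, \<lambda>i. if 0 \<le> i \<and> i < int (length w) then w ! nat i else 0)"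

definition initial :: "tm \<Rightarrow> nat list \<Rightarrow> config" where
  "initial M w = (start M, input_tape w # replicate (num_tapes M - 1) blank_tape)"

definition accepts_within :: "tm \<Rightarrow> nat list \<Rightarrow> nat \<Rightarrow> bool" where
  "accepts_within M w t \<longleftrightarrow> fst ((step M ^^ t) (initial M w)) = accept M"

definition rejects_within :: "tm \<Rightarrow> nat list \<Rightarrow> nat \<Rightarrow> bool" where
  "rejects_within M w t \<longleftrightarrow> fst ((step M ^^ t) (initial M w)) = reject M"

text \<open>\<open>codes x\<close> is the set of all words representing the instance \<open>x\<close> (an instance may have several,
  since its finite sets can be listed in different orders). The machine must answer correctly, in
  time polynomial in the length of the word, on every word that represents an instance in \<open>D\<close>;
  nothing is required on other words.\<close>

definition poly_time_decidable :: "'i set \<Rightarrow> ('i \<Rightarrow> nat list set) \<Rightarrow> ('i \<Rightarrow> bool) \<Rightarrow> bool" where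
  "poly_time_decidable D codes Q \<longleftrightarrow>
     (\<exists>(M :: tm) (p :: nat poly). wf_tm M \<and>
        (\<forall>x\<in>D. \<forall>w\<in>codes x.
           set w \<subseteq> {1..<num_symbols M} \<and>
           (if Q x then accepts_within M w (poly p (length w))
            else rejects_within M w (poly p (length w)))))"


section \<open>Encoding pairs of structures as words\<close>

text \<open>Binary digits, least significant first, without trailing zeros.\<close>

fun bits :: "nat \<Rightarrow> bool list" where
  "bits n = (if n = 0 then [] else odd n # bits (n div 2))"

declare bits.simps [simp del]

text \<open>Symbols \<open>1\<close> and \<open>2\<close> are the binary digits zero and one; \<open>3\<close>, \<open>4\<close>, \<open>5\<close> and \<open>6\<close> terminate a number,
  a list of numbers, a relation and a structure, respectively.\<close>

definition enc_nat :: "nat \<Rightarrow> nat list" where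
  "enc_nat n = map (\<lambda>b. if b then 2 else 1) (bits n) @ [3]"

definition enc_nats :: "nat list \<Rightarrow> nat list" where
  "enc_nats xs = concat (map enc_nat xs) @ [4]"

definition enc_rel :: "nat list list \<Rightarrow> nat list" where
  "enc_rel ts = concat (map enc_nats ts) @ [5]"

definition enc_structure :: "nat list \<Rightarrow> nat list list list \<Rightarrow> nat list" where
  "enc_structure us rs = enc_nats us @ concat (map enc_rel rs) @ [6]"

definition listing :: "'a list \<Rightarrow> 'a set \<Rightarrow> bool" where
  "listing xs S \<longleftrightarrow> distinct xs \<and> set xs = S"

definition structure_codes :: "'s list \<Rightarrow> ('s, nat) rel_structure \<Rightarrow> nat list set" where
  "structure_codes ss A =
     {enc_structure us rs | us rs.
        listing us (universe A) \<and> list_all2 (\<lambda>r R. listing r (rel A R)) rs ss}"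

text \<open>A code consists of the arities of the symbols, in some order, followed by the two structures,
  with their relations in the same order. The names of the symbols are not part of the code.\<close>

definition pair_codes ::
  "'s signature \<times> ('s, nat) rel_structure \<times> ('s, nat) rel_structure \<Rightarrow> nat list set" where
  "pair_codes = (\<lambda>(\<sigma>, A, B).
     {enc_nats (map (arity \<sigma>) ss) @ u @ v | ss u v.
        listing ss (symbols \<sigma>) \<and> u \<in> structure_codes ss A \<and> v \<in> structure_codes ss B})"

lemma structure_codes_nonempty:
  assumes "finite_structure \<sigma> A" "set ss \<subseteq> symbols \<sigma>"
  shows "structure_codes ss A \<noteq> {}"
proof -
  have listing_ex: "\<exists>xs. listing xs S" if "finite S" for S :: "'c set"
    using finite_distinct_list[OF that] by (auto simp: listing_def)
  have fin: "finite (rel A R)" if "R \<in> symbols \<sigma>" for R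
    by (rule finite_subset[OF _ finite_lists_length_eq[of "universe A" "arity \<sigma> R"]])
       (use assms(1) that in \<open>auto simp: finite_structure_def\<close>)
  obtain us where us: "listing us (universe A)"
    using listing_ex[of "universe A"] assms(1) unfolding finite_structure_def by blast
  define f where "f R = (SOME r. listing r (rel A R))" for R
  have f: "listing (f R) (rel A R)" if "R \<in> set ss" for R
    unfolding f_def by (rule someI_ex) (use that assms(2) fin listing_ex in blast)
  have "list_all2 (\<lambda>r R. listing r (rel A R)) (map f ss) ss"
    using f by (auto simp: list_all2_conv_all_nth)
  with us show ?thesis
    unfolding structure_codes_def by blast
qed

lemma pair_codes_nonempty:
  assumes "finite_structure \<sigma> A" "finite_structure \<sigma> B"
  shows "pair_codes (\<sigma>, A, B) \<noteq> {}"
proof -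
  obtain ss where ss: "listing ss (symbols \<sigma>)"
    using finite_distinct_list[of "symbols \<sigma>"] assms(1)
    by (auto simp: finite_structure_def listing_def)
  then have "structure_codes ss A \<noteq> {}" "structure_codes ss B \<noteq> {}"
    using structure_codes_nonempty assms by (auto simp: listing_def)
  with ss show ?thesis
    unfolding pair_codes_def by blast
qed

end

theory Submission
  imports Defs
begin

text \<open>
  Projective homomorphisms whose domain is a union of at most \<open>k\<close> hyperedges are determined by a tuple
  of \<open>B\<close> for each of \<open>k\<close> tuples of \<open>A\<close>, so for fixed \<open>k\<close> there are polynomially many of them, whereas
  the members of a winning strategy in general are exponentially many. The Duplicator wins iff some
  set of such maps offers, for each member and each choice of \<open>k\<close> tuples of \<open>A\<close>, a member defined on
  these tuples that agrees with the first one; projectivity follows because the \<open>k\<close> tuples may all be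
  the same. Elements outside all hyperedges have weight zero and only require that \<open>B\<close> has an element.
  The greatest such set is found by repeatedly deleting maps that have no answer.

  To run this on a Turing machine in polynomial time, tapes are used as stacks that hold binary trees
  in prefix notation. Functions on trees that are computable in polynomial time while leaving the
  rest of all stacks unchanged are closed under composition, iteration with polynomially bounded
  intermediate results, and hence under the usual list operations, from which the procedure is built.
\<close>

section \<open>Stack programs\<close>

text \<open>A configuration has to agree with its answer only where both are defined, and one answer
  serves a whole move: if at most \<open>k\<close> tuples cover the old domain and the new element
  inside the hyperedges, then the answer to these tuples is defined on all of that set, and
  agreement makes it repeat the old values. A position is therefore always witnessed by a single
  configuration. Conversely, a strategy may forget everything outside \<open>k\<close> chosen tuples
  before it is extended to them element by element, so that no domain on the way has weight above
  \<open>k\<close>. On the machine side, the recursion on \<open>k\<close> takes place when the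
  program is written and not when it runs, which keeps the nesting of list operations fixed. The
  delicate point is iteration: a feasible step may double its argument in every round, so each loop
  comes with a bound on all intermediate sizes.\<close>

datatype com =
    Skip
  | Push nat nat
  | Put nat nat
  | Pop nat
  | Seq com com
  | Cond nat "nat set" com com
  | Loop nat "nat set" com

type_synonym store = "nat \<Rightarrow> nat list"

text \<open>The value \<open>0\<close> for the empty stack is the blank, which is what a head scans
  when its stack is empty.\<close>

definition top_of :: "nat list \<Rightarrow> nat" where
  "top_of xs = (case xs of [] \<Rightarrow> 0 | x # _ \<Rightarrow> x)"

lemma top_of_simps [simp]: "top_of [] = 0" "top_of (x # xs) = x"
  by (simp_all add: top_of_def)

text \<open>There is no rule for \<open>Put\<close>: it is the second half of a \<open>Push\<close>, which takes a machine two
  steps because a head writes before it moves.\<close>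

inductive runs :: "com \<Rightarrow> store \<Rightarrow> nat \<Rightarrow> store \<Rightarrow> bool" where
  skip: "1 \<le> n \<Longrightarrow> runs Skip s n s"
| push: "2 \<le> n \<Longrightarrow> runs (Push i a) s n (s(i := a # s i))"
| pop: "1 \<le> n \<Longrightarrow> runs (Pop i) s n (s(i := tl (s i)))"
| seq: "runs c s m s' \<Longrightarrow> runs d s' n s'' \<Longrightarrow> m + n + 1 \<le> l \<Longrightarrow> runs (Seq c d) s l s''"
| cond_true: "top_of (s i) \<in> S \<Longrightarrow> runs c s m s' \<Longrightarrow> m + 1 \<le> n \<Longrightarrow> runs (Cond i S c d) s n s'"
| cond_false: "top_of (s i) \<notin> S \<Longrightarrow> runs d s m s' \<Longrightarrow> m + 1 \<le> n \<Longrightarrow> runs (Cond i S c d) s n s'"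
| loop_true: "top_of (s i) \<in> S \<Longrightarrow> runs c s m s' \<Longrightarrow> runs (Loop i S c) s' n s'' \<Longrightarrow> m + n + 1 \<le> l
    \<Longrightarrow> runs (Loop i S c) s l s''"
| loop_false: "top_of (s i) \<notin> S \<Longrightarrow> 1 \<le> n \<Longrightarrow> runs (Loop i S c) s n s"

text \<open>Times in \<open>runs\<close> are upper bounds and not exact counts, so later estimates
  can be rounded up freely.\<close>

lemma runs_mono:
  assumes "runs c s m s'" "m \<le> n"
  shows "runs c s n s'"
  using assms by (cases rule: runs.cases) (blast intro: runs.intros le_trans)+

text \<open>Final stores arise as nested function updates. With their equality to the desired store
  as a separate premise, it can be settled by extensionality at the end.\<close>

lemma runs_cong: "runs c s m s' \<Longrightarrow> m \<le> n \<Longrightarrow> s' = s'' \<Longrightarrow> runs c s n s''"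
  using runs_mono by blast

lemma seq_cong:
  "runs c s m s' \<Longrightarrow> runs d s' n s'' \<Longrightarrow> m + n + 1 \<le> l \<Longrightarrow> s'' = s3 \<Longrightarrow> runs (Seq c d) s l s3"
  using runs.seq by blast

text \<open>Six tapes and seven tape symbols suffice for everything below.\<close>

primrec wf_com :: "com \<Rightarrow> bool" where
  "wf_com Skip \<longleftrightarrow> True"
| "wf_com (Push i a) \<longleftrightarrow> i < 6 \<and> a < 7"
| "wf_com (Put i a) \<longleftrightarrow> i < 6 \<and> a < 7"
| "wf_com (Pop i) \<longleftrightarrow> i < 6"
| "wf_com (Seq c d) \<longleftrightarrow> wf_com c \<and> wf_com d"
| "wf_com (Cond i S c d) \<longleftrightarrow> i < 6 \<and> wf_com c \<and> wf_com d"
| "wf_com (Loop i S c) \<longleftrightarrow> i < 6 \<and> wf_com c"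


section \<open>Compilation to Turing machines\<close>

text \<open>The control state of the machine is the list of commands still to be executed; \<open>conts c K\<close>
  collects the finitely many lists that arise while \<open>c\<close> is executed in front of \<open>K\<close>.\<close>

primrec conts :: "com \<Rightarrow> com list \<Rightarrow> com list set" where
  "conts Skip K = {Skip # K}"
| "conts (Push i a) K = {Push i a # K, Put i a # K}"
| "conts (Put i a) K = {Put i a # K}"
| "conts (Pop i) K = {Pop i # K}"
| "conts (Seq c d) K = insert (Seq c d # K) (conts c (d # K) \<union> conts d K)"
| "conts (Cond i S c d) K = insert (Cond i S c d # K) (conts c K \<union> conts d K)"
| "conts (Loop i S c) K = insert (Loop i S c # K) (conts c (Loop i S c # K))"

text \<open>A stack extends to the right from its head, so pushing moves left and popping moves
  right. Each step acts on one tape only; a step that changes nothing but the control state rewrites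
  the scanned symbol of tape 0.\<close>

fun next_control :: "com list \<Rightarrow> nat list \<Rightarrow> com list \<times> nat \<times> nat \<times> move" where
  "next_control [] xs = ([], 0, xs ! 0, Stay)"
| "next_control (Skip # K) xs = (K, 0, xs ! 0, Stay)"
| "next_control (Push i a # K) xs = (Put i a # K, i, xs ! i, Go_Left)"
| "next_control (Put i a # K) xs = (K, i, a, Stay)"
| "next_control (Pop i # K) xs = (K, i, 0, Go_Right)"
| "next_control (Seq c d # K) xs = (c # d # K, 0, xs ! 0, Stay)"
| "next_control (Cond i S c d # K) xs = ((if xs ! i \<in> S then c else d) # K, 0, xs ! 0, Stay)"
| "next_control (Loop i S c # K) xs =
     (if xs ! i \<in> S then c # Loop i S c # K else K, 0, xs ! 0, Stay)"

lemma finite_conts: "finite (conts c K)"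
  by (induction c arbitrary: K) auto

lemma conts_start: "c # K \<in> conts c K"
  by (cases c) auto

text \<open>Either \<open>c\<close> is still in progress or it has just ended and \<open>K\<close>
  is reached. For \<open>K = []\<close> this closes the state set of the machine under
  transitions.\<close>

lemma next_control_conts:
  "K' \<in> conts c K \<Longrightarrow> fst (next_control K' xs) \<in> insert K (conts c K)"
proof (induction c arbitrary: K)
  case (Seq c d)
  then show ?case using conts_start[of c "d # K"] conts_start[of d K] by fastforce
next
  case (Cond i S c d)
  then show ?case using conts_start[of c K] conts_start[of d K]
    by (auto split: if_splits dest: Cond.IH)
next
  case (Loop i S c)
  then show ?case using conts_start[of c "Loop i S c # K"] by fastforce
qed auto

lemma wf_conts: "wf_com c \<Longrightarrow> list_all wf_com K \<Longrightarrow> K' \<in> conts c K \<Longrightarrow> list_all wf_com K'"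
proof (induction c arbitrary: K)
  case (Seq c d)
  then show ?case using Seq.IH(1)[of "d # K"] Seq.IH(2)[of K] by auto
next
  case (Loop i S c)
  then show ?case using Loop.IH[of "Loop i S c # K"] by auto
qed auto

lemma next_control_bounds:
  assumes "list_all wf_com K" "length xs = 6" "set xs \<subseteq> {..<7}" "next_control K xs = (K', i, a, m)"
  shows "i < 6" "a < 7"
  using assms by (cases "(K, xs)" rule: next_control.cases; force simp: subset_iff)+

definition idle :: "nat list \<Rightarrow> (nat \<times> move) list" where
  "idle xs = map (\<lambda>x. (x, Stay)) xs"

text \<open>The numbers 0 and 1 are taken by the halting states, whence the offset 2 for the control
  states numbered by \<open>g\<close>. An empty continuation means that the program has ended; the
  verdict is then read off tape 1, where 2 is the first symbol of the code of a non-leaf tree. The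
  start state is a placeholder that \<open>machine_for\<close> replaces.\<close>

definition machine :: "com list set \<Rightarrow> (com list \<Rightarrow> nat) \<Rightarrow> tm" where
  "machine Q g = \<lparr> num_tapes = 6, num_states = card Q + 2, num_symbols = 7,
     start = 0, accept = 0, reject = 1,
     delta = (\<lambda>q xs.
       if q < 2 then (q, idle xs)
       else case inv_into Q g (q - 2) of
         [] \<Rightarrow> (if xs ! 1 = 2 then 0 else 1, idle xs)
       | K \<Rightarrow> (case next_control K xs of (K', i, x) \<Rightarrow> (g K' + 2, (idle xs)[i := x]))) \<rparr>"

definition machine_for :: "com \<Rightarrow> (com list \<Rightarrow> nat) \<Rightarrow> tm" where
  "machine_for c g = (machine (insert [] (conts c [])) g) \<lparr> start := g [c] + 2 \<rparr>"

lemma wf_machine_for: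
  assumes g: "bij_betw g (insert [] (conts c [])) {0..<card (insert [] (conts c []))}"
    and c: "wf_com c"
  shows "wf_tm (machine_for c g)"
proof -
  define Q where "Q = insert [] (conts c [])"
  have gQ: "g K < card Q" if "K \<in> Q" for K
    using g that unfolding Q_def by (auto simp: bij_betw_def)
  have start: "g [c] < card Q"
    by (rule gQ) (simp add: Q_def conts_start)
  have delta: "case delta (machine_for c g) q xs of (q', acts) \<Rightarrow>
           q' < card Q + 2 \<and> length acts = 6 \<and> fst ` set acts \<subseteq> {..<7}"
    if q: "q < card Q + 2" and xs: "length xs = 6" "set xs \<subseteq> {..<7}" for q xs
  proof (cases "q < 2")
    case True
    with xs show ?thesis by (auto simp: machine_for_def machine_def idle_def)
  next
    case False
    define K where "K = inv_into Q g (q - 2)"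
    have "q - 2 \<in> g ` Q" using q False g unfolding Q_def bij_betw_def by auto
    then have K: "K \<in> Q" unfolding K_def by (rule inv_into_into)
    show ?thesis
    proof (cases K)
      case Nil
      with xs False show ?thesis
        by (auto simp: machine_for_def machine_def idle_def K_def[unfolded Q_def, symmetric])
    next
      case (Cons d K1)
      obtain K' i a m where n: "next_control K xs = (K', i, a, m)" by (metis prod_cases4)
      have "K \<in> conts c []" using K Cons by (auto simp: Q_def)
      then have K': "K' \<in> Q" and wfK: "list_all wf_com K"
        using next_control_conts[of K c "[]" xs] wf_conts[OF c, of "[]" K] n by (auto simp: Q_def)
      have ia: "i < 6" "a < 7" using next_control_bounds[OF wfK xs n] by auto
      have "set ((idle xs)[i := (a, m)]) \<subseteq> insert (a, m) (set (idle xs))"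
        by (rule set_update_subset_insert)
      moreover have "fst ` set (idle xs) \<subseteq> {..<7}" using xs by (auto simp: idle_def)
      ultimately have "fst ` set ((idle xs)[i := (a, m)]) \<subseteq> {..<7}" using ia(2) by force
      moreover have "delta (machine_for c g) q xs = (g K' + 2, (idle xs)[i := (a, m)])"
        using False Cons n by (simp add: machine_for_def machine_def K_def[unfolded Q_def, symmetric])
      ultimately show ?thesis using gQ[OF K'] xs by (simp add: idle_def)
    qed
  qed
  show ?thesis
    unfolding wf_tm_def using start delta
    by (auto simp: machine_for_def machine_def Q_def)
qed

section \<open>Tapes as stacks, and the simulation of programs by the machine\<close>

definition represents :: "tape \<Rightarrow> nat list \<Rightarrow> bool" where
  "represents t xs \<longleftrightarrow> (\<forall>i. snd t (fst t + int i) = (if i < length xs then xs ! i else 0))"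

definition represents_store :: "tape list \<Rightarrow> store \<Rightarrow> bool" where
  "represents_store ts s \<longleftrightarrow> length ts = 6 \<and> (\<forall>i<6. represents (ts ! i) (s i))"

lemma scan_represents: "represents t xs \<Longrightarrow> scan t = top_of xs"
  by (cases t; cases xs) (auto simp: represents_def dest: spec[of _ 0])

lemma act_idle: "act (scan t, Stay) t = t"
  by (cases t) auto

text \<open>This includes the empty stack: all cells from the head rightwards are blank and remain
  so when the head moves right.\<close>

lemma represents_pop: "represents t xs \<Longrightarrow> represents (act (a, Go_Right) t) (tl xs)"
proof (cases t)
  case (Pair p c)
  assume "represents t xs"
  then have "\<forall>i. c (p + int (Suc i)) = (if Suc i < length xs then xs ! Suc i else 0)"
    using Pair by (auto simp: represents_def simp del: of_nat_Suc)
  then show ?thesis using Pair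
    by (auto simp: represents_def nth_tl algebra_simps)
qed

text \<open>Cells left of the head are unconstrained, so the left move may enter a cell with any
  content; the write that follows overwrites it.\<close>

lemma represents_push:
  assumes "represents t xs"
  shows "represents (act (a, Stay) (act (scan t, Go_Left) t)) (a # xs)"
proof (cases t)
  case (Pair p c)
  then have "\<forall>i. c (p + int i) = (if i < length xs then xs ! i else 0)"
    using assms by (auto simp: represents_def)
  moreover have "p - 1 + int i = p + int (i - 1)" if "i > 0" for i using that by simp
  ultimately show ?thesis using Pair
    by (auto simp: represents_def nth_Cons split: nat.splits)
qed

lemma map2_act_idle:
  assumes "i < length ts"
  shows "map2 act ((idle (map scan ts))[i := x]) ts = ts[i := act x (ts ! i)]"
  using assms by (intro nth_equalityI) (auto simp: idle_def nth_list_update act_idle)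

lemma represents_store_update:
  "represents_store ts s \<Longrightarrow> represents t xs \<Longrightarrow> represents_store (ts[i := t]) (s(i := xs))"
  by (auto simp: represents_store_def nth_list_update)

lemma funpow_trans:
  "(f ^^ m) x = y \<Longrightarrow> (f ^^ n) y = z \<Longrightarrow> (f ^^ (m + n)) x = z" for f :: "'b \<Rightarrow> 'b"
  by (subst add.commute) (simp add: funpow_add)

lemma funpow_fixed: "f x = x \<Longrightarrow> (f ^^ n) x = x" for f :: "'b \<Rightarrow> 'b"
  by (induction n) auto

context
  fixes c0 :: com and g :: "com list \<Rightarrow> nat" and Q :: "com list set" and M :: tm
  assumes g: "bij_betw g Q {0..<card Q}"
    and Q: "Q = insert [] (conts c0 [])"
    and M: "M = machine_for c0 g"
begin

lemma machine_step:
  assumes K: "K \<in> Q" "K \<noteq> []" and ts: "length ts = 6"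
    and n: "next_control K (map scan ts) = (K', i, x)" and i: "i < 6"
  shows "step M (g K + 2, ts) = (g K' + 2, ts[i := act x (ts ! i)])"
proof -
  have inv: "inv_into Q g (g K) = K" using g K(1) by (auto simp: bij_betw_def)
  obtain d K1 where Kd: "K = d # K1" using K(2) by (cases K) auto
  have "delta M (g K + 2) (map scan ts) = (g K' + 2, (idle (map scan ts))[i := x])"
    using inv Kd n by (simp add: M machine_for_def machine_def Q)
  then show ?thesis using map2_act_idle[of i ts x] ts i
    by (simp add: M machine_for_def machine_def)
qed

lemma machine_step_silent:
  assumes K: "K \<in> Q" "K \<noteq> []" and ts: "length ts = 6"
    and n: "next_control K (map scan ts) = (K', 0, map scan ts ! 0, Stay)"
  shows "step M (g K + 2, ts) = (g K' + 2, ts)"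
  using machine_step[OF K ts n] ts by (simp add: act_idle)

lemma machine_step_final:
  assumes "length ts = 6"
  shows "step M (g [] + 2, ts) = (if scan (ts ! 1) = 2 then 0 else 1, ts)"
proof -
  have inv: "inv_into Q g (g []) = []" using g by (auto simp: bij_betw_def Q)
  have "map2 act (idle (map scan ts)) ts = ts"
    by (rule nth_equalityI) (auto simp: idle_def act_idle)
  then show ?thesis using assms inv by (auto simp: M machine_for_def machine_def Q)
qed

text \<open>The continuation \<open>K\<close> must be arbitrary in the induction: the first half of
  a sequence runs in front of \<open>d # K\<close>, and the body of a loop in front of the loop
  itself. The number of steps is existential because \<open>runs\<close> only bounds it.\<close>

lemma machine_simulates:
  assumes "runs c s n s'" "wf_com c" "conts c K \<subseteq> Q" "K \<in> Q" "represents_store ts s"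
  shows "\<exists>m ts'. m \<le> n \<and> (step M ^^ m) (g (c # K) + 2, ts) = (g K + 2, ts') \<and>
    represents_store ts' s'"
  using assms
proof (induction arbitrary: K ts rule: runs.induct)
  case (skip n s)
  then have "step M (g (Skip # K) + 2, ts) = (g K + 2, ts)"
    by (intro machine_step_silent) (auto simp: represents_store_def)
  then show ?case using skip by (intro exI[of _ 1]) (auto simp del: step.simps)
next
  case (push n i a s)
  define ts1 where "ts1 = ts[i := act (scan (ts ! i), Go_Left) (ts ! i)]"
  define ts2 where "ts2 = ts1[i := act (a, Stay) (ts1 ! i)]"
  have len: "length ts = 6" "i < 6" using push by (auto simp: represents_store_def)
  have "step M (g (Push i a # K) + 2, ts) = (g (Put i a # K) + 2, ts1)"
    unfolding ts1_def by (rule machine_step) (use push len in auto)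
  moreover have "step M (g (Put i a # K) + 2, ts1) = (g K + 2, ts2)"
    unfolding ts2_def by (rule machine_step) (use push len in \<open>auto simp: ts1_def\<close>)
  moreover have "ts2 = ts[i := act (a, Stay) (act (scan (ts ! i), Go_Left) (ts ! i))]"
    using len by (simp add: ts1_def ts2_def)
  then have "represents_store ts2 (s(i := a # s i))"
    using push(5) len(2) represents_push[of "ts ! i" "s i" a]
    by (auto intro!: represents_store_update simp: represents_store_def simp del: act.simps)
  moreover from calculation have "(step M ^^ 2) (g (Push i a # K) + 2, ts) = (g K + 2, ts2)"
    by (simp add: numeral_2_eq_2 del: step.simps)
  ultimately show ?case using push(1) by blast
next
  case (pop n i s)
  define ts1 where "ts1 = ts[i := act (0, Go_Right) (ts ! i)]"
  have len: "length ts = 6" "i < 6" using pop by (auto simp: represents_store_def)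
  have "step M (g (Pop i # K) + 2, ts) = (g K + 2, ts1)"
    unfolding ts1_def by (rule machine_step) (use pop len in auto)
  moreover have "represents_store ts1 (s(i := tl (s i)))"
    unfolding ts1_def using pop(5) len(2) represents_pop[of "ts ! i" "s i" 0]
    by (auto intro!: represents_store_update simp: represents_store_def simp del: act.simps)
  moreover from calculation have "(step M ^^ 1) (g (Pop i # K) + 2, ts) = (g K + 2, ts1)"
    by (simp del: step.simps)
  ultimately show ?case using pop(1) by blast
next
  case (seq c s m s' d n s'' l)
  have sub: "conts c (d # K) \<subseteq> Q" "conts d K \<subseteq> Q" "d # K \<in> Q" "wf_com c" "wf_com d"
    using seq.prems conts_start[of d K] by auto
  have 1: "step M (g (Seq c d # K) + 2, ts) = (g (c # d # K) + 2, ts)"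
    using seq.prems by (intro machine_step_silent) (auto simp: represents_store_def)
  obtain m1 ts1 where 2: "m1 \<le> m" "(step M ^^ m1) (g (c # d # K) + 2, ts) = (g (d # K) + 2, ts1)"
    "represents_store ts1 s'"
    using seq.IH(1)[of "d # K" ts] sub seq.prems by blast
  obtain m2 ts2 where 3: "m2 \<le> n" "(step M ^^ m2) (g (d # K) + 2, ts1) = (g K + 2, ts2)"
    "represents_store ts2 s''"
    using seq.IH(2)[of K ts1] sub seq.prems 2 by blast
  have "(step M ^^ (1 + (m1 + m2))) (g (Seq c d # K) + 2, ts) = (g K + 2, ts2)"
    by (rule funpow_trans[OF _ funpow_trans[OF 2(2) 3(2)]]) (use 1 in \<open>simp del: step.simps\<close>)
  with 2 3 seq.hyps(3) show ?case by (intro exI[of _ "1 + (m1 + m2)"] exI[of _ ts2]) auto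
next
  case (cond_true s i S c m s' n d)
  have 1: "step M (g (Cond i S c d # K) + 2, ts) = (g (c # K) + 2, ts)"
    using cond_true by (intro machine_step_silent) (auto simp: represents_store_def scan_represents)
  obtain m1 ts1 where 2: "m1 \<le> m" "(step M ^^ m1) (g (c # K) + 2, ts) = (g K + 2, ts1)"
    "represents_store ts1 s'"
    using cond_true.IH[of K ts] cond_true.prems by auto
  have "(step M ^^ (1 + m1)) (g (Cond i S c d # K) + 2, ts) = (g K + 2, ts1)"
    by (rule funpow_trans[OF _ 2(2)]) (use 1 in \<open>simp del: step.simps\<close>)
  with 2 cond_true.hyps show ?case by (intro exI[of _ "1 + m1"] exI[of _ ts1]) auto
next
  case (cond_false s i S d m s' n c)
  have 1: "step M (g (Cond i S c d # K) + 2, ts) = (g (d # K) + 2, ts)"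
    using cond_false by (intro machine_step_silent) (auto simp: represents_store_def scan_represents)
  obtain m1 ts1 where 2: "m1 \<le> m" "(step M ^^ m1) (g (d # K) + 2, ts) = (g K + 2, ts1)"
    "represents_store ts1 s'"
    using cond_false.IH[of K ts] cond_false.prems by auto
  have "(step M ^^ (1 + m1)) (g (Cond i S c d # K) + 2, ts) = (g K + 2, ts1)"
    by (rule funpow_trans[OF _ 2(2)]) (use 1 in \<open>simp del: step.simps\<close>)
  with 2 cond_false.hyps show ?case by (intro exI[of _ "1 + m1"] exI[of _ ts1]) auto
next
  case (loop_true s i S c m s' n s'' l)
  let ?L = "Loop i S c"
  have sub: "conts c (?L # K) \<subseteq> Q" "?L # K \<in> Q" "wf_com c"
    using loop_true.prems by auto
  have 1: "step M (g (?L # K) + 2, ts) = (g (c # ?L # K) + 2, ts)"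
    using loop_true by (intro machine_step_silent) (auto simp: represents_store_def scan_represents)
  obtain m1 ts1 where 2: "m1 \<le> m" "(step M ^^ m1) (g (c # ?L # K) + 2, ts) = (g (?L # K) + 2, ts1)"
    "represents_store ts1 s'"
    using loop_true.IH(1)[of "?L # K" ts] sub loop_true.prems by blast
  obtain m2 ts2 where 3: "m2 \<le> n" "(step M ^^ m2) (g (?L # K) + 2, ts1) = (g K + 2, ts2)"
    "represents_store ts2 s''"
    using loop_true.IH(2)[of K ts1] loop_true.prems 2 by blast
  have "(step M ^^ (1 + (m1 + m2))) (g (?L # K) + 2, ts) = (g K + 2, ts2)"
    by (rule funpow_trans[OF _ funpow_trans[OF 2(2) 3(2)]]) (use 1 in \<open>simp del: step.simps\<close>)
  with 2 3 loop_true.hyps show ?case by (intro exI[of _ "1 + (m1 + m2)"] exI[of _ ts2]) auto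
next
  case (loop_false s i S n c)
  then have "step M (g (Loop i S c # K) + 2, ts) = (g K + 2, ts)"
    by (intro machine_step_silent) (auto simp: represents_store_def scan_represents)
  then show ?case using loop_false by (intro exI[of _ 1]) (auto simp del: step.simps)
qed

end

lemma represents_input: "represents (input_tape w) w"
  by (auto simp: represents_def input_tape_def)

lemma represents_blank: "represents blank_tape []"
  by (auto simp: represents_def blank_tape_def)

theorem poly_time_decidable_by_com:
  fixes p :: "nat poly"
  assumes c: "wf_com c"
    and run: "\<And>x w. x \<in> D \<Longrightarrow> w \<in> codes x \<Longrightarrow>
      set w \<subseteq> {1..<7} \<and> (\<exists>s'. runs c ((\<lambda>_. [])(0 := w)) (poly p (length w)) s' \<and>
        (top_of (s' 1) = 2 \<longleftrightarrow> P x))"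
  shows "poly_time_decidable D codes P"
proof -
  define Q where "Q = insert [] (conts c [])"
  have "finite Q" by (simp add: Q_def finite_conts)
  then obtain g where g: "bij_betw g Q {0..<card Q}" using ex_bij_betw_finite_nat by blast
  define M where "M = machine_for c g"
  have wf: "wf_tm M" unfolding M_def by (rule wf_machine_for) (use g c in \<open>auto simp: Q_def\<close>)
  \<comment> \<open>The summand 1 pays for the step from the empty continuation to the
    verdict.\<close>
  have "if P x then accepts_within M w (poly (p + 1) (length w))
        else rejects_within M w (poly (p + 1) (length w))"
    if x: "x \<in> D" and w: "w \<in> codes x" for x w
  proof -
    obtain s' where s': "runs c ((\<lambda>_. [])(0 := w)) (poly p (length w)) s'"
      and P: "top_of (s' 1) = 2 \<longleftrightarrow> P x" using run[OF x w] by auto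
    define ts where "ts = input_tape w # replicate 5 blank_tape"
    have ts: "represents_store ts ((\<lambda>_. [])(0 := w))"
      unfolding represents_store_def
    proof (intro conjI allI impI)
      fix i :: nat assume "i < 6"
      then show "represents (ts ! i) (((\<lambda>_. [])(0 := w)) i)"
        using represents_input represents_blank by (cases i) (auto simp: ts_def)
    qed (simp add: ts_def)
    obtain m ts' where m: "m \<le> poly p (length w)"
      and steps: "(step M ^^ m) (g [c] + 2, ts) = (g [] + 2, ts')" and ts': "represents_store ts' s'"
      using machine_simulates[OF g Q_def M_def s' c, of "[]" ts] ts by (auto simp: Q_def)
    let ?e = "if P x then 0 else 1 :: nat"
    have "scan (ts' ! 1) = top_of (s' 1)"
      using ts' by (auto simp: represents_store_def scan_represents)
    then have final: "step M (g [] + 2, ts') = (?e, ts')"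
      using machine_step_final[OF g Q_def M_def, of ts'] ts' P by (auto simp: represents_store_def)
    have "initial M w = (g [c] + 2, ts)"
      by (simp add: initial_def M_def machine_for_def machine_def ts_def)
    then have 1: "(step M ^^ (m + 1)) (initial M w) = (?e, ts')"
      using steps final by (simp del: step.simps)
    obtain d where d: "poly (p + 1) (length w) = (m + 1) + d"
      using m by (metis add.commute add_le_mono1 le_Suc_ex poly_1 poly_add)
    \<comment> \<open>Acceptance is tested after exactly the given number of steps; halting
      configurations are fixed points of \<open>step\<close>, which fills the remaining
      time.\<close>
    have "(step M ^^ d) (?e, ts') = (?e, ts')"
      by (rule funpow_fixed) (simp add: M_def machine_for_def machine_def)
    then have "(step M ^^ poly (p + 1) (length w)) (initial M w) = (?e, ts')"
      unfolding d using funpow_trans[OF 1] by blast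
    then show ?thesis
      unfolding accepts_within_def rejects_within_def
      by (simp add: M_def machine_for_def machine_def)
  qed
  moreover have "num_symbols M = 7" by (simp add: M_def machine_for_def machine_def)
  then have "set w \<subseteq> {1..<num_symbols M}" if "x \<in> D" "w \<in> codes x" for x w
    using run[OF that] by simp
  ultimately show ?thesis
    unfolding poly_time_decidable_def using wf by blast
qed

section \<open>Trees on stacks\<close>

text \<open>The defaults make both projections total, so programs can apply them without case
  distinctions.\<close>

datatype tree = Leaf | Node (left: tree) (right: tree)
  where "left Leaf = Leaf" | "right Leaf = Leaf"

primrec code :: "tree \<Rightarrow> nat list" where
  "code Leaf = [1]"
| "code (Node a b) = 2 # code a @ code b"

primrec tsize :: "tree \<Rightarrow> nat" where
  "tsize Leaf = 1"
| "tsize (Node a b) = Suc (tsize a + tsize b)"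

lemma length_code [simp]: "length (code t) = tsize t"
  by (induction t) auto

lemma tsize_pos: "1 \<le> tsize t"
  by (cases t) auto

lemma set_code: "set (code t) \<subseteq> {1, 2}"
  by (induction t) auto

lemma top_of_code [simp]: "top_of (code t @ r) = (if t = Leaf then 1 else 2)"
  by (cases t) auto

text \<open>A prefix code ends when the number of subtrees still to be read, kept in unary on stack 3,
  drops to zero.\<close>

definition traverse_loop :: "nat \<Rightarrow> nat \<Rightarrow> com" where
  "traverse_loop i j = Loop 3 {1} (Cond i {2}
     (Seq (Pop i) (Seq (Push j 2) (Push 3 1)))
     (Seq (Pop i) (Seq (Push j 1) (Pop 3))))"

text \<open>The symbol 3 below the counter stops the loop whatever stack 3 held before; the 1 above
  it stands for the single tree to be read.\<close>

definition traverse :: "nat \<Rightarrow> nat \<Rightarrow> com" where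
  "traverse i j = Seq (Push 3 3) (Seq (Push 3 1) (Seq (traverse_loop i j) (Pop 3)))"

primrec pushes :: "nat \<Rightarrow> nat list \<Rightarrow> com" where
  "pushes a [] = Skip"
| "pushes a (i # js) = Seq (Push i a) (pushes a js)"

definition unreverse :: "nat list \<Rightarrow> com" where
  "unreverse js = Loop 2 {1, 2} (Cond 2 {1} (Seq (Pop 2) (pushes 1 js)) (Seq (Pop 2) (pushes 2 js)))"

text \<open>Moves the tree on top of stack \<open>i\<close> to all stacks in \<open>js\<close>, through stack 2.\<close>

definition copy :: "nat \<Rightarrow> nat list \<Rightarrow> com" where
  "copy i js = Seq (Push 2 3) (Seq (traverse i 2) (Seq (unreverse js) (Pop 2)))"

lemma runs_cong_start: "runs c s m s' \<Longrightarrow> s = s0 \<Longrightarrow> runs c s0 m s'"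
  by simp

text \<open>The loop does not end between two subtrees, so the statement has continuation form: a
  run that starts after the tree has been moved yields one that starts before. For a node the
  hypothesis for the right subtree is applied first, then the one for the left. Each symbol costs 8
  steps for the body and 1 for the test.\<close>

lemma runs_traverse_loop:
  assumes "runs (traverse_loop i j) (s(i := r, j := rev (code t) @ s j, 3 := q)) n s'"
    "s i = code t @ r" "s 3 = 1 # q" "i \<noteq> j" "i \<noteq> 3" "j \<noteq> 3"
  shows "runs (traverse_loop i j) s (n + 9 * tsize t) s'"
  using assms
proof (induction t arbitrary: s r q n)
  case Leaf
  have "runs (Cond i {2} (Seq (Pop i) (Seq (Push j 2) (Push 3 1)))
      (Seq (Pop i) (Seq (Push j 1) (Pop 3)))) s 8 (s(i := r, j := 1 # s j, 3 := q))"
    by (rule cond_false[where m = 7], use Leaf in simp)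
      (rule seq_cong[OF pop[of 1] seq_cong[OF push[of 2] pop[of 1] le_refl refl]],
        use Leaf in \<open>auto simp: fun_eq_iff\<close>)
  moreover have "runs (traverse_loop i j) (s(i := r, j := 1 # s j, 3 := q)) n s'"
    by (rule runs_cong_start[OF Leaf(1)]) (auto simp: fun_eq_iff)
  ultimately show ?case unfolding traverse_loop_def
    by (rule loop_true[rotated]) (use Leaf in auto)
next
  case (Node a b)
  define s1 where "s1 = s(i := code a @ code b @ r, j := 2 # s j, 3 := 1 # 1 # q)"
  have 1: "runs (Cond i {2} (Seq (Pop i) (Seq (Push j 2) (Push 3 1)))
      (Seq (Pop i) (Seq (Push j 1) (Pop 3)))) s 8 s1"
    by (rule cond_true[where m = 7], use Node.prems in simp)
      (rule seq_cong[OF pop[of 1] seq_cong[OF push[of 2] push[of 2] le_refl refl]],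
        use Node.prems in \<open>auto simp: fun_eq_iff s1_def\<close>)
  define s2 where "s2 = s1(i := code b @ r, j := rev (code a) @ s1 j, 3 := 1 # q)"
  have "runs (traverse_loop i j) s2 (n + 9 * tsize b) s'"
  proof (rule Node.IH(2)[of s2 r q])
    show "runs (traverse_loop i j) (s2(i := r, j := rev (code b) @ s2 j, 3 := q)) n s'"
      by (rule runs_cong_start[OF Node.prems(1)])
        (use Node.prems(4-) in \<open>auto simp: s2_def s1_def fun_eq_iff\<close>)
  qed (use Node.prems in \<open>auto simp: s2_def s1_def\<close>)
  then have "runs (traverse_loop i j) s1 (n + 9 * tsize b + 9 * tsize a) s'"
    unfolding s2_def by (rule Node.IH(1)) (use Node.prems in \<open>auto simp: s1_def\<close>)
  with 1 show ?case unfolding traverse_loop_def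
    by (rule loop_true[rotated]) (use Node.prems in auto)
qed

lemma runs_traverse:
  assumes "s i = code t @ r" "i \<noteq> j" "i \<noteq> 3" "j \<noteq> 3"
  shows "runs (traverse i j) s (9 * tsize t + 9) (s(i := r, j := rev (code t) @ s j))"
proof -
  let ?s = "s(3 := 1 # 3 # s 3)"
  let ?s' = "?s(i := r, j := rev (code t) @ ?s j, 3 := 3 # s 3)"
  have "runs (traverse_loop i j) ?s' 1 ?s'"
    unfolding traverse_loop_def by (rule loop_false) auto
  then have 1: "runs (traverse_loop i j) ?s (1 + 9 * tsize t) ?s'"
    by (rule runs_traverse_loop) (use assms in auto)
  let ?s0 = "s(3 := 3 # s 3)"
  have "runs (traverse_loop i j) (?s0(3 := 1 # ?s0 3)) (1 + 9 * tsize t) ?s'"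
    by (rule runs_cong_start[OF 1]) (auto simp: fun_eq_iff)
  then have "runs (Seq (traverse_loop i j) (Pop 3)) (?s0(3 := 1 # ?s0 3)) (9 * tsize t + 3)
      (s(i := r, j := rev (code t) @ s j))"
    by (rule seq_cong[OF _ pop[OF le_refl]]) (use assms in \<open>auto simp: fun_eq_iff\<close>)
  then show ?thesis
    unfolding traverse_def
    by (intro seq[OF push[OF le_refl]]) (auto intro: seq[OF push[OF le_refl]])
qed

lemma runs_pushes:
  "distinct js \<Longrightarrow> runs (pushes a js) s (3 * length js + 1) (\<lambda>k. if k \<in> set js then a # s k else s k)"
proof (induction js arbitrary: s)
  case Nil
  show ?case by (auto intro: skip)
next
  case (Cons i js)
  then show ?case
    unfolding pushes.simps
    by (intro seq_cong[OF push[of 2] Cons.IH]) (use Cons.prems in \<open>auto simp: fun_eq_iff\<close>)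
qed

lemma runs_unreverse:
  assumes "s 2 = xs @ 3 # q" "set xs \<subseteq> {1, 2}" "distinct js" "length js \<le> 2" "2 \<notin> set js"
  shows "runs (unreverse js) s (12 * length xs + 1)
    (\<lambda>k. if k = 2 then 3 # q else if k \<in> set js then rev xs @ s k else s k)"
  using assms
proof (induction xs arbitrary: s)
  case Nil
  then have "s = (\<lambda>k. if k = 2 then 3 # q else if k \<in> set js then rev [] @ s k else s k)"
    by (auto simp: fun_eq_iff)
  then show ?case unfolding unreverse_def
    using loop_false[of s 2 "{1, 2}" 1] Nil by auto
next
  case (Cons x xs)
  define s1 where "s1 = s(2 := xs @ 3 # q)"
  define s2 where "s2 = (\<lambda>k. if k \<in> set js then x # s1 k else s1 k)"
  have "runs (pushes x js) s1 7 s2"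
    unfolding s2_def by (rule runs_mono[OF runs_pushes]) (use Cons.prems in auto)
  then have "runs (pushes x js) (s(2 := tl (s 2))) 7 s2"
    using Cons.prems(1) by (simp add: s1_def)
  then have "runs (Seq (Pop 2) (pushes x js)) s 9 s2"
    by (rule seq[OF pop[OF le_refl]]) auto
  moreover have "x = 1 \<or> x = 2" using Cons.prems(2) by auto
  ultimately have 1: "runs (Cond 2 {1} (Seq (Pop 2) (pushes 1 js)) (Seq (Pop 2) (pushes 2 js))) s 10 s2"
    using Cons.prems(1) by (auto intro: cond_true cond_false)
  have 2: "runs (unreverse js) s2 (12 * length xs + 1)
    (\<lambda>k. if k = 2 then 3 # q else if k \<in> set js then rev xs @ s2 k else s2 k)"
    by (rule Cons.IH) (use Cons.prems in \<open>auto simp: s2_def s1_def\<close>)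
  have "runs (unreverse js) s (12 * length (x # xs) + 1)
    (\<lambda>k. if k = 2 then 3 # q else if k \<in> set js then rev xs @ s2 k else s2 k)"
    unfolding unreverse_def
    by (rule loop_true[OF _ 1 2[unfolded unreverse_def]]) (use Cons.prems in auto)
  moreover have "(\<lambda>k. if k = 2 then 3 # q else if k \<in> set js then rev xs @ s2 k else s2 k) =
    (\<lambda>k. if k = 2 then 3 # q else if k \<in> set js then rev (x # xs) @ s k else s k)"
    using Cons.prems by (auto simp: fun_eq_iff s2_def s1_def)
  ultimately show ?case by simp
qed

text \<open>Trees have size at least 1, so a generous factor absorbs all additive constants.\<close>

lemma runs_copy:
  assumes "s i = code t @ r" "i \<noteq> 2" "i \<noteq> 3" "2 \<notin> set js" "distinct js" "length js \<le> 2"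
  shows "runs (copy i js) s (60 * tsize t)
    (\<lambda>k. if k \<in> set js then code t @ (s(i := r)) k else (s(i := r)) k)"
proof -
  define s1 where "s1 = s(2 := 3 # s 2)"
  define s2 where "s2 = s1(i := r, 2 := rev (code t) @ s1 2)"
  have 1: "runs (traverse i 2) s1 (9 * tsize t + 9) s2"
    unfolding s2_def by (rule runs_traverse) (use assms in \<open>auto simp: s1_def\<close>)
  have 2: "runs (unreverse js) s2 (12 * length (rev (code t)) + 1)
    (\<lambda>k. if k = 2 then 3 # s 2 else if k \<in> set js then rev (rev (code t)) @ s2 k else s2 k)"
    by (rule runs_unreverse) (use assms set_code[of t] in \<open>auto simp: s2_def s1_def\<close>)
  show ?thesis unfolding copy_def
    by (rule seq_cong[OF push[of 2] seq_cong[OF 1[unfolded s1_def] seq_cong[OF 2 pop[of 1]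
        le_refl refl] le_refl refl]])
      (use assms tsize_pos[of t] in \<open>auto simp: fun_eq_iff s2_def s1_def\<close>)
qed

lemma wf_pushes: "a < 7 \<Longrightarrow> \<forall>i\<in>set js. i < 6 \<Longrightarrow> wf_com (pushes a js)"
  by (induction js) auto

lemma wf_copy: "i < 6 \<Longrightarrow> \<forall>i\<in>set js. i < 6 \<Longrightarrow> wf_com (copy i js)"
  by (simp add: copy_def traverse_def traverse_loop_def unreverse_def wf_pushes)

lemma runs_drop:
  "s i = code t @ r \<Longrightarrow> i \<noteq> 2 \<Longrightarrow> i \<noteq> 3 \<Longrightarrow> runs (copy i []) s (60 * tsize t) (s(i := r))"
  by (rule runs_cong[OF runs_copy[where js = "[]"]]) (auto simp: fun_eq_iff)

lemma runs_move:
  assumes "s i = code t @ r" "i \<noteq> 2" "i \<noteq> 3" "j \<noteq> 2" "i \<noteq> j"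
  shows "runs (copy i [j]) s (60 * tsize t) (s(i := r, j := code t @ s j))"
  by (rule runs_cong[OF runs_copy[where js = "[j]"]]) (use assms in \<open>auto simp: fun_eq_iff\<close>)

definition duplicate :: com where
  "duplicate = Seq (copy 1 [1, 4]) (copy 4 [1])"

definition swap :: com where
  "swap = Seq (copy 1 [4]) (Seq (copy 1 [5]) (Seq (copy 4 [1]) (copy 5 [1])))"

lemma wf_duplicate: "wf_com duplicate" and wf_swap: "wf_com swap"
  by (auto simp: duplicate_def swap_def intro!: wf_copy)

lemma runs_duplicate:
  assumes "s 1 = code t @ r"
  shows "runs duplicate s (121 * tsize t) (s(1 := code t @ code t @ r))"
proof -
  have 1: "runs (copy 1 [1, 4]) s (60 * tsize t) (s(1 := code t @ r, 4 := code t @ s 4))"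
    by (rule runs_cong[OF runs_copy[where js = "[1, 4]"]]) (use assms in \<open>auto simp: fun_eq_iff\<close>)
  show ?thesis unfolding duplicate_def
    by (rule seq_cong[OF 1 runs_move[of _ _ t "s 4"]])
      (use tsize_pos[of t] in \<open>auto simp: fun_eq_iff\<close>)
qed

lemma runs_swap:
  assumes "s 1 = code a @ code b @ r"
  shows "runs swap s (123 * (tsize a + tsize b)) (s(1 := code b @ code a @ r))"
  unfolding swap_def
  by (rule seq_cong[OF runs_move[of _ _ a "code b @ r"] seq_cong[OF runs_move[of _ _ b r]
       seq_cong[OF runs_move[of _ _ a "s 4"] runs_move[of _ _ b "s 5"] le_refl refl] le_refl refl]])
    (use assms tsize_pos[of a] in \<open>auto simp: fun_eq_iff\<close>)


section \<open>Polynomial-time functions on trees\<close>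

text \<open>The result is a word and not a tree, so that a program may leave several trees on stack
  1, as in \<open>computes_pair\<close>.\<close>

definition computes :: "com \<Rightarrow> nat poly \<Rightarrow> (tree \<Rightarrow> nat list) \<Rightarrow> bool" where
  "computes c p f \<longleftrightarrow> wf_com c \<and>
     (\<forall>t s r. s 1 = code t @ r \<longrightarrow> runs c s (poly p (tsize t)) (s(1 := f t @ r)))"

text \<open>The size of the result is bounded along with the time because the next program in a
  composition is charged for the size of its argument.\<close>

definition feasible :: "(tree \<Rightarrow> tree) \<Rightarrow> bool" where
  "feasible f \<longleftrightarrow> (\<exists>c p. computes c p (\<lambda>t. code (f t)) \<and> (\<forall>t. tsize (f t) \<le> poly p (tsize t)))"

lemma poly_mono_nat: "x \<le> y \<Longrightarrow> poly p x \<le> poly p y" for p :: "nat poly"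
  by (induction p) (auto intro!: add_mono mult_le_mono)

lemma computesI:
  assumes "wf_com c" "\<And>t s r. s 1 = code t @ r \<Longrightarrow> runs c s (poly p (tsize t)) (s(1 := f t @ r))"
  shows "computes c p f"
  using assms by (auto simp: computes_def)

lemma computesD:
  assumes "computes c p f" "s 1 = code t @ r" "s' = s(1 := f t @ r)" "poly p (tsize t) \<le> n"
  shows "runs c s n s'"
  using assms runs_mono unfolding computes_def by blast

lemma computes_wf: "computes c p f \<Longrightarrow> wf_com c"
  by (simp add: computes_def)

lemma feasibleE:
  assumes "feasible f"
  obtains c p where "computes c p (\<lambda>t. code (f t))" "\<And>t. tsize (f t) \<le> poly p (tsize t)"
  using assms by (auto simp: feasible_def)

lemma feasibleI:
  assumes c: "computes c p (\<lambda>t. code (f t))" and q: "\<And>t. tsize (f t) \<le> poly q (tsize t)"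
  shows "feasible f"
  unfolding feasible_def
proof (intro exI conjI allI)
  show "computes c (p + q) (\<lambda>t. code (f t))"
    by (rule computesI) (use c in \<open>auto intro: computesD simp: computes_wf\<close>)
  show "tsize (f t) \<le> poly (p + q) (tsize t)" for t
    using q[of t] by simp
qed

lemma feasible_comp:
  assumes "feasible f" "feasible g"
  shows "feasible (\<lambda>t. f (g t))"
proof -
  obtain c p where c: "computes c p (\<lambda>t. code (f t))" "\<And>t. tsize (f t) \<le> poly p (tsize t)"
    using assms(1) by (rule feasibleE) blast
  obtain d q where d: "computes d q (\<lambda>t. code (g t))" "\<And>t. tsize (g t) \<le> poly q (tsize t)"
    using assms(2) by (rule feasibleE) blast
  have le: "poly p (tsize (g t)) \<le> poly p (poly q (tsize t))" for t
    by (rule poly_mono_nat[OF d(2)])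
  show ?thesis
  proof (rule feasibleI)
    show "computes (Seq d c) (q + pcompose p q + 1) (\<lambda>t. code (f (g t)))"
    proof (rule computesI)
      fix t r and s :: store assume s: "s 1 = code t @ r"
      show "runs (Seq d c) s (poly (q + pcompose p q + 1) (tsize t)) (s(1 := code (f (g t)) @ r))"
        by (rule seq[OF computesD[OF d(1), where s = s and t = t and r = r, OF s refl le_refl] computesD[OF c(1) _ _ le]])
          (auto simp: poly_pcompose)
    qed (use c d in \<open>auto simp: computes_wf\<close>)
    show "tsize (f (g t)) \<le> poly (pcompose p q) (tsize t)" for t
      using le_trans[OF c(2) le] by (simp add: poly_pcompose)
  qed
qed

lemma feasible_id: "feasible (\<lambda>t. t)"
  by (rule feasibleI[of Skip 1 _ "[:0, 1:]"]) (auto intro!: computesI runs_cong[OF skip[OF le_refl]] simp: fun_eq_iff)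

text \<open>Evaluating \<open>g\<close> on the first copy of the argument, and \<open>f\<close>
  after a swap, leaves the value of \<open>f\<close> on top: pushing the symbol 2 then completes the
  code of a node.\<close>

lemma computes_pair:
  assumes "feasible f" "feasible g"
  shows "\<exists>c p. computes c p (\<lambda>t. code (f t) @ code (g t))"
proof -
  obtain c p where c: "computes c p (\<lambda>t. code (f t))"
    using assms(1) by (rule feasibleE) blast
  obtain d q where d: "computes d q (\<lambda>t. code (g t))" "\<And>t. tsize (g t) \<le> poly q (tsize t)"
    using assms(2) by (rule feasibleE) blast
  have "computes (Seq duplicate (Seq d (Seq swap c))) ([:3, 244:] + p + smult 124 q)
    (\<lambda>t. code (f t) @ code (g t))"
  proof (rule computesI)
    fix t r and s :: store assume s: "s 1 = code t @ r"
    define s1 where "s1 = s(1 := code t @ code t @ r)"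
    define s2 where "s2 = s(1 := code (g t) @ code t @ r)"
    define s3 where "s3 = s(1 := code t @ code (g t) @ r)"
    have 1: "runs duplicate s (121 * tsize t) s1"
      unfolding s1_def by (rule runs_duplicate[of s t r, OF s])
    have 2: "runs d s1 (poly q (tsize t)) s2"
      by (rule computesD[OF d(1)]) (auto simp: s1_def s2_def)
    have 3: "runs swap s2 (123 * (tsize (g t) + tsize t)) s3"
      by (rule runs_cong[OF runs_swap[of _ "g t" t r]]) (auto simp: s2_def s3_def)
    have 4: "runs c s3 (poly p (tsize t)) (s(1 := code (f t) @ code (g t) @ r))"
      by (rule computesD[OF c]) (auto simp: s3_def)
    show "runs (Seq duplicate (Seq d (Seq swap c))) s (poly ([:3, 244:] + p + smult 124 q) (tsize t))
       (s(1 := (code (f t) @ code (g t)) @ r))"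
      by (rule seq_cong[OF 1 seq_cong[OF 2 seq_cong[OF 3 4 le_refl refl] le_refl refl]])
        (use d(2)[of t] in auto)
  qed (use c d in \<open>auto simp: computes_wf wf_duplicate wf_swap\<close>)
  then show ?thesis by blast
qed

lemma feasible_Node:
  assumes "feasible f" "feasible g"
  shows "feasible (\<lambda>t. Node (f t) (g t))"
proof -
  obtain c p where c: "computes c p (\<lambda>t. code (f t) @ code (g t))"
    using computes_pair[OF assms] by blast
  obtain pf where pf: "\<And>t. tsize (f t) \<le> poly pf (tsize t)"
    using assms(1) by (rule feasibleE) blast
  obtain pg where pg: "\<And>t. tsize (g t) \<le> poly pg (tsize t)"
    using assms(2) by (rule feasibleE) blast
  show ?thesis
  proof (rule feasibleI)
    show "computes (Seq c (Push 1 2)) (p + 3) (\<lambda>t. code (Node (f t) (g t)))"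
    proof (rule computesI)
      fix t r and s :: store assume s: "s 1 = code t @ r"
      show "runs (Seq c (Push 1 2)) s (poly (p + 3) (tsize t)) (s(1 := code (Node (f t) (g t)) @ r))"
        by (rule seq_cong[OF computesD[OF c, where s = s and t = t and r = r, OF s refl le_refl] push[of 2]]) auto
    qed (use c in \<open>auto simp: computes_wf\<close>)
    show "tsize (Node (f t) (g t)) \<le> poly (1 + pf + pg) (tsize t)" for t
      using pf[of t] pg[of t] by simp
  qed
qed

lemma feasible_right: "feasible right"
proof (rule feasibleI)
  show "computes (Cond 1 {2} (Seq (Pop 1) (copy 1 [])) Skip) [:3, 60:] (\<lambda>t. code (right t))"
  proof (rule computesI)
    fix t r and s :: store assume s: "s 1 = code t @ r"
    show "runs (Cond 1 {2} (Seq (Pop 1) (copy 1 [])) Skip) s (poly [:3, 60:] (tsize t))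
      (s(1 := code (right t) @ r))"
    proof (cases t)
      case Leaf
      with s show ?thesis
        by (intro cond_false[where m = 1] runs_cong[OF skip[of 1]]) (auto simp: fun_eq_iff)
    next
      case (Node a b)
      have "runs (Seq (Pop 1) (copy 1 [])) s (60 * tsize a + 2) (s(1 := code (right t) @ r))"
        by (rule seq_cong[OF pop[of 1] runs_drop[of _ _ a "code b @ r"]]) (use s Node in auto)
      then show ?thesis using s Node by (intro cond_true) auto
    qed
  qed (auto intro!: wf_copy)
  show "tsize (right t) \<le> poly [:0, 1:] (tsize t)" for t by (cases t) auto
qed

lemma feasible_left: "feasible left"
proof (rule feasibleI)
  show "computes (Cond 1 {2} (Seq (Pop 1) (Seq swap (copy 1 []))) Skip) [:4, 183:]
    (\<lambda>t. code (left t))"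
  proof (rule computesI)
    fix t r and s :: store assume s: "s 1 = code t @ r"
    show "runs (Cond 1 {2} (Seq (Pop 1) (Seq swap (copy 1 []))) Skip) s (poly [:4, 183:] (tsize t))
      (s(1 := code (left t) @ r))"
    proof (cases t)
      case Leaf
      with s show ?thesis
        by (intro cond_false[where m = 1] runs_cong[OF skip[of 1]]) (auto simp: fun_eq_iff)
    next
      case (Node a b)
      have "runs (Seq (Pop 1) (Seq swap (copy 1 []))) s
          (1 + (123 * (tsize a + tsize b) + 60 * tsize b + 1) + 1) (s(1 := code (left t) @ r))"
        by (rule seq_cong[OF pop[of 1] seq_cong[OF runs_swap[of _ a b r]
              runs_drop[of _ _ b "code a @ r"]  le_refl refl]]) (use s Node in auto)
      then show ?thesis using s Node by (intro cond_true) auto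
    qed
  qed (auto simp: wf_swap intro!: wf_copy)
  show "tsize (left t) \<le> poly [:0, 1:] (tsize t)" for t by (cases t) auto
qed

lemma feasible_const: "feasible (\<lambda>_. c)"
proof (induction c)
  case Leaf
  show ?case
  proof (rule feasibleI)
    show "computes (Seq (copy 1 []) (Push 1 1)) [:3, 60:] (\<lambda>t. code Leaf)"
      by (intro computesI seq_cong[OF runs_drop push[of 2]]) (auto intro!: wf_copy)
    show "tsize Leaf \<le> poly 1 (tsize t)" for t by simp
  qed
next
  case (Node a b)
  then show ?case by (rule feasible_Node)
qed

lemma feasible_if_Leaf:
  assumes "feasible f" "feasible g" "feasible h"
  shows "feasible (\<lambda>t. if f t = Leaf then g t else h t)"
proof -
  obtain e pe where e: "computes e pe (\<lambda>t. code (f t) @ code t)"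
    using computes_pair[OF assms(1) feasible_id] by blast
  obtain pf where pf: "\<And>t. tsize (f t) \<le> poly pf (tsize t)"
    using assms(1) by (rule feasibleE) blast
  obtain c pc where c: "computes c pc (\<lambda>t. code (g t))" "\<And>t. tsize (g t) \<le> poly pc (tsize t)"
    using assms(2) by (rule feasibleE) blast
  obtain d pd where d: "computes d pd (\<lambda>t. code (h t))" "\<And>t. tsize (h t) \<le> poly pd (tsize t)"
    using assms(3) by (rule feasibleE) blast
  let ?c = "Seq e (Cond 1 {1} (Seq (copy 1 []) c) (Seq (copy 1 []) d))"
  show ?thesis
  proof (rule feasibleI)
    show "computes ?c (pe + smult 60 pf + pc + pd + 3)
      (\<lambda>t. code (if f t = Leaf then g t else h t))"
    proof (rule computesI)
      fix t r and s :: store assume s: "s 1 = code t @ r"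
      define s1 where "s1 = s(1 := code (f t) @ code t @ r)"
      have 1: "runs e s (poly pe (tsize t)) s1"
        by (rule computesD[OF e, where s = s and t = t and r = r, OF s]) (auto simp: s1_def)
      have 2: "runs (copy 1 []) s1 (60 * tsize (f t)) (s(1 := code t @ r))"
        by (rule runs_cong[OF runs_drop[of _ _ "f t" "code t @ r"]]) (auto simp: s1_def)
      have "runs (Seq (copy 1 []) c) s1 (60 * poly pf (tsize t) + poly pc (tsize t) + 1)
           (s(1 := code (g t) @ r))"
        by (rule seq[OF 2 computesD[OF c(1) _ _ le_refl]]) (use pf[of t] in auto)
      moreover
      have "runs (Seq (copy 1 []) d) s1 (60 * poly pf (tsize t) + poly pd (tsize t) + 1)
           (s(1 := code (h t) @ r))"
        by (rule seq[OF 2 computesD[OF d(1) _ _ le_refl]]) (use pf[of t] in auto)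
      ultimately have "runs (Cond 1 {1} (Seq (copy 1 []) c) (Seq (copy 1 []) d)) s1
         (60 * poly pf (tsize t) + poly pc (tsize t) + poly pd (tsize t) + 2)
         (s(1 := code (if f t = Leaf then g t else h t) @ r))"
        by (cases "f t = Leaf") (auto intro: cond_true cond_false simp: s1_def)
      with 1 show "runs ?c s (poly (pe + smult 60 pf + pc + pd + 3) (tsize t))
        (s(1 := code (if f t = Leaf then g t else h t) @ r))"
        by (rule seq) auto
    qed (use c d e in \<open>auto simp: computes_wf intro!: wf_copy\<close>)
    show "tsize (if f t = Leaf then g t else h t) \<le> poly (pc + pd) (tsize t)" for t
      using c(2)[of t] d(2)[of t] by simp
  qed
qed


subsection \<open>Lists and iteration\<close>

text \<open>Read along right spines, trees and lists of trees are in bijection, so every tree is a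
  well-formed list. Lists also serve as unary counters through their length.\<close>

fun ls :: "tree \<Rightarrow> tree list" where
  "ls Leaf = []"
| "ls (Node a b) = a # ls b"

fun mk :: "tree list \<Rightarrow> tree" where
  "mk [] = Leaf"
| "mk (x # xs) = Node x (mk xs)"

lemma ls_mk [simp]: "ls (mk xs) = xs"
  by (induction xs) auto

lemma mk_ls [simp]: "mk (ls t) = t"
  by (induction t) auto

lemma mk_eq_Leaf [simp]: "mk xs = Leaf \<longleftrightarrow> xs = []"
  by (cases xs) auto

lemma ls_eq_Nil [simp]: "ls t = [] \<longleftrightarrow> t = Leaf"
  by (cases t) auto

lemma length_ls: "length (ls t) < tsize t"
  by (induction t) auto

lemma tsize_mk: "tsize (mk xs) = 1 + (\<Sum>x\<leftarrow>xs. tsize x + 1)"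
  by (induction xs) auto

lemma tsize_elem: "x \<in> set (ls t) \<Longrightarrow> tsize x < tsize t"
  by (induction t) auto

text \<open>Removing the node symbol and the head from the prefix code on stack 5 leaves the code of
  the tail, which counts the rounds. The body may use stack 5 itself, since \<open>computes\<close>
  restores it.\<close>

definition iterate_loop :: "com \<Rightarrow> com" where
  "iterate_loop c = Loop 5 {2} (Seq (Pop 5) (Seq (copy 5 []) c))"

lemma runs_iterate_loop:
  assumes c: "computes c p (\<lambda>t. code (f t))"
    and "s 1 = code x @ r" "s 5 = code n @ q"
    and "\<And>j. j < length (ls n) \<Longrightarrow> poly p (tsize ((f ^^ j) x)) \<le> B" "tsize n \<le> N"
  shows "runs (iterate_loop c) s (length (ls n) * (60 * N + B + 4) + 1)
    (s(1 := code ((f ^^ length (ls n)) x) @ r, 5 := 1 # q))"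
  using assms(2-)
proof (induction n arbitrary: s x)
  case Leaf
  then have "s = s(1 := code x @ r, 5 := 1 # q)" by (auto simp: fun_eq_iff)
  with Leaf show ?case unfolding iterate_loop_def
    by (intro runs_cong[OF loop_false[OF _ le_refl]]) auto
next
  case (Node h n)
  let ?C = "Seq (Pop 5) (Seq (copy 5 []) c)"
  let ?s = "s(1 := code (f x) @ r, 5 := code n @ q)"
  have B: "poly p (tsize x) \<le> B" using Node.prems(3)[of 0] by simp
  have "runs ?C s (60 * tsize h + B + 3) ?s"
    by (rule seq_cong[OF pop[of 1] seq_cong[OF runs_drop[of _ _ h "code n @ q"]
            computesD[OF c _ refl B] le_refl refl]]) (use Node.prems in auto)
  moreover have "runs (iterate_loop c) ?s (length (ls n) * (60 * N + B + 4) + 1)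
    (?s(1 := code ((f ^^ length (ls n)) (f x)) @ r, 5 := 1 # q))"
  proof (rule Node.IH(2))
    show "poly p (tsize ((f ^^ j) (f x))) \<le> B" if "j < length (ls n)" for j
      using Node.prems(3)[of "Suc j"] that by (simp add: funpow_swap1)
  qed (use Node.prems in auto)
  ultimately have "runs (iterate_loop c) s (length (ls (Node h n)) * (60 * N + B + 4) + 1)
    (?s(1 := code ((f ^^ length (ls n)) (f x)) @ r, 5 := 1 # q))"
    unfolding iterate_loop_def by (rule loop_true[rotated]) (use Node.prems in auto)
  then show ?case by (rule runs_cong) (auto simp: funpow_swap1 fun_eq_iff)
qed

text \<open>The bound \<open>q\<close> on all iterates rules out exponential growth and makes the
  cost of a round uniform.\<close>

lemma feasible_iterate:
  fixes q :: "nat poly"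
  assumes "feasible f" "feasible n" "feasible g"
    and q: "\<And>t j. j \<le> length (ls (n t)) \<Longrightarrow> tsize ((f ^^ j) (g t)) \<le> poly q (tsize t)"
  shows "feasible (\<lambda>t. (f ^^ length (ls (n t))) (g t))"
proof -
  obtain d pd where d: "computes d pd (\<lambda>t. code (n t) @ code (g t))"
    using computes_pair[OF assms(2,3)] by blast
  obtain pn where pn: "\<And>t. tsize (n t) \<le> poly pn (tsize t)"
    using assms(2) by (rule feasibleE) blast
  obtain c p where c: "computes c p (\<lambda>t. code (f t))"
    using assms(1) by (rule feasibleE) blast
  let ?c = "Seq d (Seq (copy 1 [5]) (Seq (iterate_loop c) (Pop 5)))"
  let ?p = "pd + smult 60 pn + pn * (smult 60 pn + pcompose p q + 4) + 5"
  show ?thesis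
  proof (rule feasibleI)
    show "computes ?c ?p (\<lambda>t. code ((f ^^ length (ls (n t))) (g t)))"
    proof (rule computesI)
      fix t r and s :: store assume s: "s 1 = code t @ r"
      define s1 where "s1 = s(1 := code (n t) @ code (g t) @ r)"
      define s2 where "s2 = s(1 := code (g t) @ r, 5 := code (n t) @ s 5)"
      define s3 where "s3 = s2(1 := code ((f ^^ length (ls (n t))) (g t)) @ r, 5 := 1 # s 5)"
      let ?B = "poly p (poly q (tsize t))"
      have 1: "runs d s (poly pd (tsize t)) s1"
        by (rule computesD[OF d, where s = s and t = t and r = r, OF s]) (auto simp: s1_def)
      have 2: "runs (copy 1 [5]) s1 (60 * tsize (n t)) s2"
        by (rule runs_cong[OF runs_move[of _ _ "n t" "code (g t) @ r"]]) (auto simp: s1_def s2_def)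
      have 3: "runs (iterate_loop c) s2 (length (ls (n t)) * (60 * poly pn (tsize t) + ?B + 4) + 1) s3"
        unfolding s3_def
        by (rule runs_iterate_loop[OF c]) (auto simp: s2_def pn intro!: poly_mono_nat q)
      have "length (ls (n t)) \<le> poly pn (tsize t)" using length_ls[of "n t"] pn[of t] by simp
      then show "runs ?c s (poly ?p (tsize t)) (s(1 := code ((f ^^ length (ls (n t))) (g t)) @ r))"
        by (intro seq_cong[OF 1 seq_cong[OF 2 seq_cong[OF 3 pop[of 1] le_refl refl] le_refl refl]])
          (use pn[of t] in \<open>auto simp: s2_def s3_def poly_pcompose fun_eq_iff
            intro: add_mono mult_le_mono1\<close>)
    qed (use c d in \<open>auto simp: computes_wf iterate_loop_def intro!: wf_copy\<close>)
    show "tsize ((f ^^ length (ls (n t))) (g t)) \<le> poly q (tsize t)" for t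
      by (rule q) simp
  qed
qed

lemma funpow_nonincreasing: "(\<And>t. tsize (f t) \<le> tsize t) \<Longrightarrow> tsize ((f ^^ j) t) \<le> tsize t"
  by (induction j) (auto intro: le_trans)

lemma feasible_iterate_nonincreasing:
  assumes "feasible f" "feasible n" "feasible g" and f: "\<And>t. tsize (f t) \<le> tsize t"
  shows "feasible (\<lambda>t. (f ^^ length (ls (n t))) (g t))"
proof -
  obtain p where p: "\<And>t. tsize (g t) \<le> poly p (tsize t)"
    using assms(3) by (rule feasibleE) blast
  show ?thesis
    by (rule feasible_iterate[OF assms(1-3)])
      (blast intro: le_trans[OF funpow_nonincreasing[of f, OF f] p])
qed

lemma feasible_left_comp: "feasible f \<Longrightarrow> feasible (\<lambda>t. left (f t))"
  by (rule feasible_comp[OF feasible_left])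

lemma feasible_right_comp: "feasible f \<Longrightarrow> feasible (\<lambda>t. right (f t))"
  by (rule feasible_comp[OF feasible_right])

lemmas feasible_basic = feasible_left_comp feasible_right_comp feasible_Node feasible_id feasible_const

text \<open>Moving one list cell onto an accumulator preserves the size, which makes reversal the
  basic list operation.\<close>

lemma feasible_revapp:
  assumes "feasible f" "feasible g"
  shows "feasible (\<lambda>t. mk (rev (ls (f t)) @ ls (g t)))"
proof -
  define st where "st z = (if left z = Leaf then z else Node (right (left z)) (Node (left (left z)) (right z)))"
    for z
  have "tsize (st z) \<le> tsize z" for z
    unfolding st_def by (cases z; cases "left z") auto
  moreover have "feasible st"
    unfolding st_def by (intro feasible_if_Leaf feasible_basic)
  ultimately have "feasible (\<lambda>t. (st ^^ length (ls (f t))) (Node (f t) (g t)))"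
    using assms by (intro feasible_iterate_nonincreasing feasible_Node)
  moreover have "(st ^^ length (ls x)) (Node x y) = Node Leaf (mk (rev (ls x) @ ls y))" for x y
    by (induction x arbitrary: y) (auto simp: funpow_swap1 st_def)
  ultimately show ?thesis using feasible_right_comp by fastforce
qed

lemma feasible_rev: "feasible f \<Longrightarrow> feasible (\<lambda>t. mk (rev (ls (f t))))"
  using feasible_revapp[of f "\<lambda>_. Leaf"] feasible_const by simp

lemma feasible_append:
  assumes "feasible f" "feasible g"
  shows "feasible (\<lambda>t. mk (ls (f t) @ ls (g t)))"
  using feasible_revapp[OF feasible_rev[OF assms(1)] assms(2)] by simp

text \<open>The iterated state carries \<open>t\<close> beside the remaining and the finished
  elements. This lets \<open>F\<close> depend on its environment, which is what later comprehensions
  and quantifiers with free variables rest on.\<close>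

lemma feasible_map:
  assumes F: "feasible (\<lambda>p. F (left p) (right p))" and h: "feasible h"
  shows "feasible (\<lambda>t. mk (map (F t) (ls (h t))))"
proof -
  define st where "st z = Node (left z) (Node (right (left (right z)))
      (Node (F (left z) (left (left (right z)))) (right (right z))))" for z
  define g where "g t = Node t (Node (h t) Leaf)" for t
  obtain pF where pF: "\<And>p. tsize (F (left p) (right p)) \<le> poly pF (tsize p)"
    using F by (rule feasibleE) blast
  obtain ph where ph: "\<And>t. tsize (h t) \<le> poly ph (tsize t)"
    using h by (rule feasibleE) blast
  \<comment> \<open>The polynomial \<open>[:1, 1:] + ph\<close> bounds the size of
    \<open>Node t x\<close> for an element \<open>x\<close> of the list.\<close>
  define q where "q = pcompose pF ([:1, 1:] + ph)"
  have iter: "(st ^^ j) (Node t (Node x (mk acc))) =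
      Node t (Node (mk (drop j (ls x))) (mk (rev (map (F t) (take j (ls x))) @ acc)))"
    if "j \<le> length (ls x)" for j t x acc
    using that
  proof (induction j arbitrary: x acc)
    case (Suc j)
    then obtain y z where x: "x = Node y z" by (cases x) auto
    have "st (Node t (Node x (mk acc))) = Node t (Node z (mk (F t y # acc)))"
      by (simp add: st_def x)
    then show ?case using Suc.IH[of z "F t y # acc"] Suc.prems x
      by (simp add: funpow_swap1 del: mk.simps)
  qed simp
  have size: "tsize ((st ^^ j) (g t)) \<le> poly ([:4, 1:] + ph + ph * (q + 1)) (tsize t)"
    if j: "j \<le> length (ls (h t))" for j t
  proof -
    let ?xs = "ls (h t)"
    have F: "tsize (F t x) \<le> poly q (tsize t)" if "x \<in> set ?xs" for x
    proof -
      have "tsize (Node t x) \<le> 1 + tsize t + poly ph (tsize t)"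
        using tsize_elem[OF that] ph[of t] by simp
      then have "poly pF (tsize (Node t x)) \<le> poly q (tsize t)"
        unfolding q_def poly_pcompose by (intro poly_mono_nat) simp
      then show ?thesis using pF[of "Node t x"] by simp
    qed
    have "(\<Sum>x\<leftarrow>map (F t) (take j ?xs). tsize x + 1) \<le> (\<Sum>x\<leftarrow>take j ?xs. poly q (tsize t) + 1)"
      unfolding map_map o_def by (rule sum_list_mono) (use F in \<open>auto dest: in_set_takeD\<close>)
    also have "\<dots> = min j (length ?xs) * (poly q (tsize t) + 1)"
      by (simp add: sum_list_triv min.commute del: mult_Suc_right)
    also have "\<dots> \<le> poly ph (tsize t) * (poly q (tsize t) + 1)"
      using length_ls[of "h t"] ph[of t] by (intro mult_le_mono1) simp
    finally have 1: "tsize (mk (rev (map (F t) (take j ?xs)))) \<le>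
        1 + poly ph (tsize t) * (poly q (tsize t) + 1)"
      by (simp add: tsize_mk rev_map[symmetric] sum_list_rev)
    have "tsize (mk (drop j xs)) \<le> tsize (mk xs)" for xs
      using arg_cong[OF append_take_drop_id[of j xs], of "\<lambda>xs. tsize (mk xs)"]
      unfolding tsize_mk map_append sum_list_append by linarith
    from this[of ?xs] have "tsize (mk (drop j ?xs)) \<le> tsize (h t)" by simp
    with 1 ph[of t] show ?thesis
      using iter[OF j, of t "[]"] by (simp add: g_def)
  qed
  have "feasible st"
    unfolding st_def
    by (intro feasible_basic feasible_comp[OF F, of "\<lambda>z. Node (left z) (left (left (right z)))", simplified])
  moreover have "feasible g"
    unfolding g_def using h by (intro feasible_basic)
  ultimately have "feasible (\<lambda>t. (st ^^ length (ls (h t))) (g t))"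
    using h size by (intro feasible_iterate)
  then have "feasible (\<lambda>t. right (right ((st ^^ length (ls (h t))) (g t))))"
    by (intro feasible_basic)
  moreover have "right (right ((st ^^ length (ls (h t))) (g t))) = mk (rev (map (F t) (ls (h t))))" for t
    using iter[OF order_refl, of "h t" t "[]"] by (simp add: g_def)
  ultimately have "feasible (\<lambda>t. mk (rev (map (F t) (ls (h t)))))" by simp
  from feasible_rev[OF this] show ?thesis by simp
qed

text \<open>Prepending one member to the accumulator loses a leaf and a node, so sizes do not grow.
  The list is reversed beforehand because its last member must be prepended first.\<close>

lemma feasible_concat:
  assumes "feasible h"
  shows "feasible (\<lambda>t. mk (concat (map ls (ls (h t)))))"
proof -
  define st where "st z = Node (right (left z)) (mk (ls (left (left z)) @ ls (right z)))" for z
  have app: "tsize (mk (ls a @ ls b)) + 1 = tsize a + tsize b" for a b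
    by (induction a) auto
  have "tsize (st z) \<le> tsize z" if "left z \<noteq> Leaf" for z
    using that app[of "left (left z)" "right z"] unfolding st_def
    by (cases z; cases "left z") auto
  \<comment> \<open>The guard also secures the size bound: \<open>st Leaf\<close> would be
    \<open>Node Leaf Leaf\<close>.\<close>
  define st' where "st' z = (if left z = Leaf then z else st z)" for z
  have "tsize (st' z) \<le> tsize z" for z
    using \<open>\<And>z. left z \<noteq> Leaf \<Longrightarrow> tsize (st z) \<le> tsize z\<close> by (simp add: st'_def)
  moreover have "feasible st'"
    unfolding st'_def st_def by (intro feasible_if_Leaf feasible_append feasible_basic)
  ultimately have "feasible (\<lambda>t. (st' ^^ length (ls (mk (rev (ls (h t))))))
      (Node (mk (rev (ls (h t)))) Leaf))"
    using assms by (intro feasible_iterate_nonincreasing feasible_basic feasible_rev)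
  moreover have "(st' ^^ length (ls x)) (Node x y) =
      Node Leaf (mk (concat (map ls (rev (ls x))) @ ls y))" for x y
    by (induction x arbitrary: y) (auto simp: funpow_swap1 st_def st'_def)
  then have "(st' ^^ length (ls (mk (rev (ls x))))) (Node (mk (rev (ls x))) Leaf) =
      Node Leaf (mk (concat (map ls (ls x))))" for x
    by (metis append_Nil2 ls.simps(1) ls_mk rev_rev_ident)
  ultimately have "feasible (\<lambda>t. Node Leaf (mk (concat (map ls (ls (h t))))))" by simp
  from feasible_right_comp[OF this] show ?thesis by simp
qed

lemma feasible_bind:
  assumes "feasible (\<lambda>p. F (left p) (right p))" "feasible h"
  shows "feasible (\<lambda>t. mk (concat (map (\<lambda>x. ls (F t x)) (ls (h t)))))"
  using feasible_concat[OF feasible_map[OF assms]] by (simp add: o_def)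


subsection \<open>Polynomial-time predicates on trees\<close>

definition feasible_pred :: "(tree \<Rightarrow> bool) \<Rightarrow> bool" where
  "feasible_pred P \<longleftrightarrow> feasible (\<lambda>t. if P t then Node Leaf Leaf else Leaf)"

lemma feasible_pred_eq_Leaf: "feasible f \<Longrightarrow> feasible_pred (\<lambda>t. f t = Leaf)"
  unfolding feasible_pred_def by (intro feasible_if_Leaf feasible_const)

lemma feasible_if:
  assumes "feasible_pred P" "feasible f" "feasible g"
  shows "feasible (\<lambda>t. if P t then f t else g t)"
proof -
  have "(\<lambda>t. if P t then f t else g t) =
      (\<lambda>t. if (if P t then Node Leaf Leaf else Leaf) = Leaf then g t else f t)" by auto
  then show ?thesis using feasible_if_Leaf[OF assms(1)[unfolded feasible_pred_def] assms(3,2)] by simp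
qed

lemma feasible_pred_not:
  assumes "feasible_pred P"
  shows "feasible_pred (\<lambda>t. \<not> P t)"
proof -
  have "(\<lambda>t. if \<not> P t then Node Leaf Leaf else Leaf) =
      (\<lambda>t. if P t then Leaf else Node Leaf Leaf)" by auto
  then show ?thesis
    using feasible_if[OF assms feasible_const feasible_const] by (simp add: feasible_pred_def)
qed

lemma feasible_pred_conj:
  assumes "feasible_pred P" "feasible_pred Q"
  shows "feasible_pred (\<lambda>t. P t \<and> Q t)"
proof -
  have "(\<lambda>t. if P t \<and> Q t then Node Leaf Leaf else Leaf) =
      (\<lambda>t. if P t then (if Q t then Node Leaf Leaf else Leaf) else Leaf)" by auto
  then show ?thesis
    using feasible_if[OF assms(1) assms(2)[unfolded feasible_pred_def] feasible_const[of Leaf]]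
    by (simp add: feasible_pred_def)
qed

lemma feasible_pred_disj:
  assumes "feasible_pred P" "feasible_pred Q"
  shows "feasible_pred (\<lambda>t. P t \<or> Q t)"
  using feasible_pred_not[OF feasible_pred_conj[OF assms[THEN feasible_pred_not]]] by simp

lemma feasible_pred_imp:
  assumes "feasible_pred P" "feasible_pred Q"
  shows "feasible_pred (\<lambda>t. P t \<longrightarrow> Q t)"
  unfolding imp_conv_disj by (intro feasible_pred_disj feasible_pred_not assms)

lemma feasible_filter:
  assumes "feasible_pred (\<lambda>p. P (left p) (right p))" "feasible h"
  shows "feasible (\<lambda>t. mk (filter (P t) (ls (h t))))"
proof -
  have "feasible (\<lambda>p. if P (left p) (right p) then Node (right p) Leaf else Leaf)"
    by (intro feasible_if assms feasible_basic)
  then have "feasible (\<lambda>t. mk (concat (map (\<lambda>x. ls (if P t x then Node x Leaf else Leaf)) (ls (h t)))))"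
    by (rule feasible_bind[OF _ assms(2)])
  moreover have "concat (map (\<lambda>x. ls (if Q x then Node x Leaf else Leaf)) xs) = filter Q xs" for Q xs
    by (induction xs) auto
  ultimately show ?thesis by simp
qed

lemma feasible_pred_ex:
  assumes "feasible_pred (\<lambda>p. P (left p) (right p))" "feasible h"
  shows "feasible_pred (\<lambda>t. \<exists>x\<in>set (ls (h t)). P t x)"
  using feasible_pred_not[OF feasible_pred_eq_Leaf[OF feasible_filter[OF assms]]]
  by (simp add: filter_empty_conv)

lemma feasible_pred_all:
  assumes "feasible_pred (\<lambda>p. P (left p) (right p))" "feasible h"
  shows "feasible_pred (\<lambda>t. \<forall>x\<in>set (ls (h t)). P t x)"
  using feasible_pred_not[OF feasible_pred_ex[OF feasible_pred_not[OF assms(1)] assms(2)]] by simp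

text \<open>These rules are syntax-directed: for a procedure written with projections, conditionals,
  comprehensions and bounded quantifiers, feasibility follows by introduction alone.\<close>

lemmas feasible_intros =
  feasible_basic feasible_if feasible_map feasible_bind feasible_filter feasible_append
  feasible_pred_eq_Leaf feasible_pred_not feasible_pred_conj feasible_pred_disj feasible_pred_imp
  feasible_pred_ex feasible_pred_all


section \<open>Folding over the input word\<close>

definition dispatch :: "(nat \<Rightarrow> com) \<Rightarrow> nat list \<Rightarrow> com" where
  "dispatch c as = foldr (\<lambda>a d. Cond 0 {a} (Seq (Pop 0) (c a)) d) as Skip"

lemma runs_dispatch:
  assumes "a \<in> set as" "s 0 = a # w" "runs (c a) (s(0 := w)) n s'"
  shows "runs (dispatch c as) s (n + 2 + length as) s'"
  using assms(1)
proof (induction as)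
  case (Cons b as)
  show ?case
  proof (cases "b = a")
    case True
    have "runs (Seq (Pop 0) (c a)) s (n + 2) s'"
      by (rule seq[OF pop[of 1]]) (use assms in auto)
    then show ?thesis using True assms(2)
      by (auto simp: dispatch_def intro: cond_true)
  next
    case False
    with Cons assms(2) show ?thesis by (auto simp: dispatch_def intro: cond_false)
  qed
qed simp

text \<open>Each step is charged for the state reached so far, hence \<open>B\<close> must be a
  bound at every proper prefix of the word.\<close>

lemma runs_fold:
  assumes c: "\<And>a. a \<in> {1..<7} \<Longrightarrow> computes (c a) (p a) (\<lambda>t. code (f a t))"
    and "s 0 = w" "s 1 = code x" "set w \<subseteq> {1..<7}"
    and "\<And>a u v. w = u @ a # v \<Longrightarrow> poly (p a) (tsize (fold f u x)) \<le> B"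
  shows "runs (Loop 0 {1..<7} (dispatch c [1..<7])) s (length w * (B + 10) + 1)
    (s(0 := [], 1 := code (fold f w x)))"
  using assms(2-)
proof (induction w arbitrary: s x)
  case Nil
  then have "s = s(0 := [], 1 := code x)" by (auto simp: fun_eq_iff)
  with Nil show ?case by (intro runs_cong[OF loop_false[OF _ le_refl]]) auto
next
  case (Cons a w)
  have a: "a \<in> {1..<7}" using Cons.prems by auto
  have "poly (p a) (tsize x) \<le> B" using Cons.prems(4)[of "[]" a w] by simp
  then have 1: "runs (c a) (s(0 := w)) B (s(0 := w, 1 := code (f a x)))"
    using Cons.prems by (intro computesD[OF c[OF a], where r = "[]" and t = x]) auto
  have 2: "runs (dispatch c [1..<7]) s (B + 8) (s(0 := w, 1 := code (f a x)))"
    by (rule runs_mono[OF runs_dispatch[where as = "[1..<7]" and c = c, OF _ Cons.prems(1) 1]])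
      (use a in auto)
  have 3: "runs (Loop 0 {1..<7} (dispatch c [1..<7])) (s(0 := w, 1 := code (f a x)))
      (length w * (B + 10) + 1)
      ((s(0 := w, 1 := code (f a x)))(0 := [], 1 := code (fold f w (f a x))))"
  proof (rule Cons.IH)
    show "poly (p b) (tsize (fold f u (f a x))) \<le> B" if "w = u @ b # v" for b u v
      using Cons.prems(4)[of "a # u" b v] that by simp
  qed (use Cons.prems in auto)
  have 4: "runs (Loop 0 {1..<7} (dispatch c [1..<7])) s (length (a # w) * (B + 10) + 1)
      ((s(0 := w, 1 := code (f a x)))(0 := [], 1 := code (fold f w (f a x))))"
    by (rule loop_true[OF _ 2 3]) (use Cons.prems a in auto)
  show ?case by (rule runs_cong[OF 4]) (auto simp: fun_eq_iff)
qed

lemma runs_push_word: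
  "runs (foldr (\<lambda>a d. Seq d (Push 1 a)) w Skip) s (3 * length w + 1) (s(1 := w @ s 1))"
proof (induction w)
  case (Cons a w)
  show ?case unfolding foldr_Cons o_def
    by (rule seq_cong[OF Cons push[of 2]]) auto
qed (auto intro: skip)

text \<open>This is the interface between machines and trees: a one-pass parser with feasible steps
  and states of polynomial size, followed by a feasible test. The bound \<open>q\<close> is needed
  for the same reason as in \<open>feasible_iterate\<close>.\<close>

theorem poly_time_decidable_by_fold:
  fixes q :: "nat poly"
  assumes f: "\<And>a. feasible (f a)" and P: "feasible_pred P"
    and q: "\<And>w. set w \<subseteq> {1..<7} \<Longrightarrow> tsize (fold f w x0) \<le> poly q (length w)"
    and dec: "\<And>x w. x \<in> D \<Longrightarrow> w \<in> codes x \<Longrightarrow> set w \<subseteq> {1..<7} \<and> (P (fold f w x0) \<longleftrightarrow> R x)"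
  shows "poly_time_decidable D codes R"
proof -
  have "\<exists>c p. computes c p (\<lambda>t. code (f a t))" for a using f[of a] by (auto simp: feasible_def)
  then obtain c p where c: "\<And>a. computes (c a) (p a) (\<lambda>t. code (f a t))" by metis
  obtain d pd where d: "computes d pd (\<lambda>t. code (if P t then Node Leaf Leaf else Leaf))"
    using P unfolding feasible_pred_def feasible_def by blast
  define init where "init = foldr (\<lambda>a d. Seq d (Push 1 a)) (code x0) Skip"
  have wf_init: "wf_com init"
  proof -
    have "wf_com (foldr (\<lambda>a d. Seq d (Push 1 a)) w Skip)" if "set w \<subseteq> {..<7}" for w
      using that by (induction w) auto
    then show ?thesis using set_code[of x0] unfolding init_def by fastforce
  qed
  have wf_dispatch: "wf_com (dispatch c as)" for as
    using computes_wf[OF c] by (induction as) (auto simp: dispatch_def)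
  define pB where "pB = (\<Sum>a\<in>{1..<7}. pcompose (p a) q)"
  let ?l = "Loop 0 {1..<7} (dispatch c [1..<7])"
  let ?p = "[:3 * tsize x0 + 4:] + [:0, 1:] * (pB + 10) + pcompose pd q"
  show ?thesis
  proof (rule poly_time_decidable_by_com)
    show "wf_com (Seq init (Seq ?l d))"
      using wf_init wf_dispatch d by (auto simp: computes_wf)
    fix x w assume x: "x \<in> D" "w \<in> codes x"
    let ?s = "(\<lambda>_. [])(0 := w)"
    let ?t = "fold f w x0"
    let ?e = "if P ?t then Node Leaf Leaf else Leaf"
    have w: "set w \<subseteq> {1..<7}" using dec[OF x] by blast
    have 1: "runs init ?s (3 * tsize x0 + 1) (?s(1 := code x0))"
      unfolding init_def by (rule runs_cong[OF runs_push_word]) auto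
    have 2: "runs ?l (?s(1 := code x0)) (length w * (poly pB (length w) + 10) + 1)
      ((?s(1 := code x0))(0 := [], 1 := code ?t))"
    proof (rule runs_fold[OF c])
      fix a u v assume uv: "w = u @ a # v"
      then have a: "a \<in> {1..<7}" using w by auto
      have "tsize (fold f u x0) \<le> poly q (length u)" using q[of u] w uv by auto
      also have "\<dots> \<le> poly q (length w)" using uv by (intro poly_mono_nat) auto
      finally have "poly (p a) (tsize (fold f u x0)) \<le> poly (pcompose (p a) q) (length w)"
        unfolding poly_pcompose by (rule poly_mono_nat)
      also have "\<dots> \<le> poly pB (length w)"
        unfolding pB_def poly_sum using a by (intro member_le_sum) auto
      finally show "poly (p a) (tsize (fold f u x0)) \<le> poly pB (length w)" .
    qed (use w in auto)
    have 3: "runs d ((?s(1 := code x0))(0 := [], 1 := code ?t)) (poly (pcompose pd q) (length w))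
      ((\<lambda>_. [])(1 := code ?e))"
      by (rule computesD[OF d, of _ ?t "[]"])
        (auto simp: poly_pcompose fun_eq_iff intro: poly_mono_nat q[OF w])
    have "runs (Seq init (Seq ?l d)) ?s (poly ?p (length w)) ((\<lambda>_. [])(1 := code ?e))"
      by (rule seq[OF 1 seq[OF 2 3 le_refl]]) (simp add: algebra_simps)
    moreover have "top_of (code ?e) = 2 \<longleftrightarrow> R x" using dec[OF x] by auto
    ultimately show "set w \<subseteq> {1..<7} \<and> (\<exists>s'. runs (Seq init (Seq ?l d)) ?s (poly ?p (length w)) s' \<and>
        (top_of (s' 1) = 2 \<longleftrightarrow> R x))"
      using w by (intro conjI exI[of _ "(\<lambda>_. [])(1 := code ?e)"]) auto
  qed
qed

section \<open>The decision procedure on trees\<close>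

lemma feasible_comp2:
  assumes "feasible (\<lambda>p. F (left p) (right p))" "feasible f" "feasible g"
  shows "feasible (\<lambda>t. F (f t) (g t))"
  using feasible_comp[OF assms(1) feasible_Node[OF assms(2,3)]] by simp

lemma feasible_pred_comp: "feasible_pred P \<Longrightarrow> feasible g \<Longrightarrow> feasible_pred (\<lambda>t. P (g t))"
  unfolding feasible_pred_def by (rule feasible_comp)

lemma feasible_pred_comp2:
  assumes "feasible_pred (\<lambda>p. P (left p) (right p))" "feasible f" "feasible g"
  shows "feasible_pred (\<lambda>t. P (f t) (g t))"
  using feasible_pred_comp[OF assms(1) feasible_Node[OF assms(2,3)]] by simp

lemma feasible_pred_const: "feasible_pred (\<lambda>_. P)"
  unfolding feasible_pred_def by (rule feasible_const)

text \<open>The step is stationary once either list is exhausted, which matches the truncation in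
  \<open>map2\<close>.\<close>

lemma feasible_zip:
  assumes "feasible f" "feasible g"
  shows "feasible (\<lambda>t. mk (map2 Node (ls (f t)) (ls (g t))))"
proof -
  define st where "st z = (if left (left z) = Leaf \<or> right (left z) = Leaf then z
    else Node (Node (right (left (left z))) (right (right (left z))))
      (Node (Node (left (left (left z))) (left (right (left z)))) (right z)))" for z
  have "tsize (st z) \<le> tsize z" for z
    unfolding st_def by (cases z; cases "left z"; cases "left (left z)"; cases "right (left z)") auto
  moreover have "feasible st"
    unfolding st_def by (intro feasible_intros)
  ultimately have "feasible (\<lambda>t. (st ^^ length (ls (f t))) (Node (Node (f t) (g t)) Leaf))"
    using assms by (intro feasible_iterate_nonincreasing feasible_basic)
  then have "feasible (\<lambda>t. mk (rev (ls (right ((st ^^ length (ls (f t))) (Node (Node (f t) (g t)) Leaf))))))"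
    by (intro feasible_rev feasible_basic)
  moreover have "right ((st ^^ length (ls x)) (Node (Node x y) acc)) =
      mk (rev (map2 Node (ls x) (ls y)) @ ls acc)" for x y acc
  proof (induction x arbitrary: y acc)
    case (Node a x)
    note IH = Node.IH(2)
    show ?case
    proof (cases y)
      case Leaf
      have "st (Node (Node (Node a x) Leaf) acc) = Node (Node (Node a x) Leaf) acc"
        by (simp add: st_def)
      then show ?thesis using Leaf funpow_fixed[of st] by simp
    next
      case (Node b y')
      have "st (Node (Node (Node a x) (Node b y')) acc) = Node (Node x y') (Node (Node a b) acc)"
        by (simp add: st_def)
      then show ?thesis using Node IH[of y' "Node (Node a b) acc"]
        by (simp add: funpow_swap1)
    qed
  qed simp
  ultimately show ?thesis by simp
qed

text \<open>Equal first bits are stripped, and the state gets stuck at the first difference; the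
  lists are equal iff both are used up. Comparing heads with \<open>Leaf\<close> only is enough for
  lists of bits.\<close>

definition eq_step :: "tree \<Rightarrow> tree" where
  "eq_step z = (if left z \<noteq> Leaf \<and> right z \<noteq> Leaf \<and>
       ((left (left z) = Leaf \<longrightarrow> left (right z) = Leaf) \<and>
        (left (right z) = Leaf \<longrightarrow> left (left z) = Leaf))
     then Node (right (left z)) (right (right z)) else z)"

definition same_bits :: "tree \<Rightarrow> tree \<Rightarrow> bool" where
  "same_bits x y \<longleftrightarrow> left ((eq_step ^^ length (ls x)) (Node x y)) = Leaf \<and>
     right ((eq_step ^^ length (ls x)) (Node x y)) = Leaf"

lemma feasible_same_bits:
  assumes "feasible f" "feasible g"
  shows "feasible_pred (\<lambda>t. same_bits (f t) (g t))"
proof -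
  have "tsize (eq_step z) \<le> tsize z" for z
    unfolding eq_step_def by (cases z; cases "left z"; cases "right z") auto
  moreover have "feasible eq_step"
    unfolding eq_step_def by (intro feasible_intros)
  ultimately have "feasible (\<lambda>t. (eq_step ^^ length (ls (f t))) (Node (f t) (g t)))"
    using assms by (intro feasible_iterate_nonincreasing feasible_basic)
  then show ?thesis unfolding same_bits_def by (intro feasible_intros)
qed

definition bit :: "bool \<Rightarrow> tree" where
  "bit b = (if b then Node Leaf Leaf else Leaf)"

lemma same_bits_iff: "same_bits (mk (map bit xs)) (mk (map bit ys)) \<longleftrightarrow> xs = ys"
proof (induction xs arbitrary: ys)
  case Nil
  show ?case by (cases ys) (auto simp: same_bits_def)
next
  case (Cons x xs)
  show ?case
  proof (cases "ys \<noteq> [] \<and> hd ys = x")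
    case True
    then obtain zs where zs: "ys = x # zs" by (cases ys) auto
    then have "eq_step (Node (mk (map bit (x # xs))) (mk (map bit ys))) =
        Node (mk (map bit xs)) (mk (map bit zs))"
      by (auto simp: eq_step_def)
    then show ?thesis using Cons[of zs] zs by (auto simp: same_bits_def funpow_swap1)
  next
    case False
    then have "eq_step (Node (mk (map bit (x # xs))) (mk (map bit ys))) =
        Node (mk (map bit (x # xs))) (mk (map bit ys))"
      by (cases ys) (auto simp: eq_step_def bit_def)
    then have "\<not> same_bits (mk (map bit (x # xs))) (mk (map bit ys))"
      unfolding same_bits_def by (subst (1 2) funpow_fixed) auto
    then show ?thesis using False by auto
  qed
qed

text \<open>A configuration is an association list, describing a partial map.\<close>

definition consistent :: "tree \<Rightarrow> tree \<Rightarrow> bool" where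
  "consistent c d \<longleftrightarrow> (\<forall>p\<in>set (ls c). \<forall>q\<in>set (ls d).
     same_bits (left p) (left q) \<longrightarrow> same_bits (right p) (right q))"

lemma feasible_consistent:
  assumes "feasible f" "feasible g"
  shows "feasible_pred (\<lambda>t. consistent (f t) (g t))"
proof (rule feasible_pred_comp2[OF _ assms])
  show "feasible_pred (\<lambda>p. consistent (left p) (right p))"
    unfolding consistent_def by (intro feasible_intros feasible_same_bits)
qed

text \<open>Each tuple of the first structure yields a group: its positionwise pairings with all
  tuples of the corresponding relation of the second. A tuple with repeated entries may give a
  pairing that is not a function. The shells \<open>ls (mk ...)\<close> give the term the shape of
  \<open>feasible_bind\<close>.\<close>

definition pairings :: "tree \<Rightarrow> tree \<Rightarrow> tree" where
  "pairings sa sb = mk (concat (map (\<lambda>z. ls (mk (map (\<lambda>x. mk (map (\<lambda>y.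
     mk (map2 Node (ls x) (ls y))) (ls (right z)))) (ls (left z)))))
     (ls (mk (map2 Node (ls sa) (ls sb))))))"

lemma feasible_pairings:
  assumes "feasible f" "feasible g"
  shows "feasible (\<lambda>t. pairings (f t) (g t))"
proof (rule feasible_comp2[OF _ assms])
  show "feasible (\<lambda>p. pairings (left p) (right p))"
    unfolding pairings_def by (intro feasible_intros feasible_zip)
qed

text \<open>The groups of \<open>choices k g\<close> correspond to the \<open>k\<close>-tuples of members of \<open>g\<close>; the members of a
  group arise by choosing one element from each component and concatenating the results.\<close>

primrec choices :: "nat \<Rightarrow> 'b list list list \<Rightarrow> 'b list list list" where
  "choices 0 g = [[[]]]"
| "choices (Suc k) g = concat (map (\<lambda>x. map (\<lambda>grp. concat (map (\<lambda>p. map (\<lambda>c. p @ c) grp) x))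
     (choices k g)) g)"

primrec groups :: "nat \<Rightarrow> tree \<Rightarrow> tree" where
  "groups 0 g = mk [mk [mk []]]"
| "groups (Suc k) g = mk (concat (map (\<lambda>x. ls (mk (map (\<lambda>grp. mk (concat (map (\<lambda>p.
     ls (mk (map (\<lambda>c. mk (ls p @ ls c)) (ls grp)))) (ls x)))) (ls (groups k g))))) (ls g)))"

text \<open>Every \<open>k\<close> has its own program, and the degree of its polynomial may grow
  with \<open>k\<close>.\<close>

lemma feasible_groups: "feasible (groups k)"
proof (induction k)
  case 0
  show ?case unfolding groups.simps by (rule feasible_const)
next
  case (Suc k)
  show ?case unfolding groups.simps by (intro feasible_intros feasible_comp[OF Suc])
qed

lemma groups_mk:
  "groups k (mk (map (\<lambda>g. mk (map mk g)) g)) = mk (map (\<lambda>g. mk (map mk g)) (choices k g))"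
  by (induction k) (simp_all add: map_concat o_def)

text \<open>Consistency of \<open>c\<close> with itself says that the association list is a
  function.\<close>

definition initial_groups :: "nat \<Rightarrow> tree \<Rightarrow> tree" where
  "initial_groups k g = mk (map (\<lambda>grp. mk (filter (\<lambda>c. consistent c c) (ls grp))) (ls (groups k g)))"

definition refine :: "tree \<Rightarrow> tree" where
  "refine s = mk (map (\<lambda>grp. mk (filter (\<lambda>c. \<forall>grp'\<in>set (ls s). \<exists>d\<in>set (ls grp'). consistent c d)
     (ls grp))) (ls s))"

text \<open>The initial number of configurations is enough rounds, since a round that changes
  anything deletes at least one of them.\<close>

definition final_groups :: "nat \<Rightarrow> tree \<Rightarrow> tree" where
  "final_groups k g = (refine ^^ length (ls (mk (concat (map ls (ls (initial_groups k g)))))))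
     (initial_groups k g)"

lemma feasible_initial_groups: "feasible (initial_groups k)"
  unfolding initial_groups_def
  by (intro feasible_intros feasible_consistent feasible_comp[OF feasible_groups])

lemma feasible_refine: "feasible refine"
  unfolding refine_def by (intro feasible_intros feasible_consistent)

lemma tsize_filter: "tsize (mk (filter P xs)) \<le> tsize (mk xs)"
  by (induction xs) auto

lemma tsize_refine: "tsize (refine s) \<le> tsize s"
proof -
  have "tsize (mk (map (\<lambda>grp. mk (filter P (ls grp))) gs)) \<le> tsize (mk gs)" for P gs
  proof (induction gs)
    case (Cons g gs)
    then show ?case using tsize_filter[of P "ls g"] by simp
  qed simp
  from this[of _ "ls s"] show ?thesis by (simp add: refine_def)
qed

lemma feasible_final_groups: "feasible (final_groups k)"
  unfolding final_groups_def
  by (intro feasible_iterate_nonincreasing feasible_refine feasible_initial_groups feasible_concat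
      tsize_refine)

section \<open>Stable sets and the greatest fixed point of deletion\<close>

lemma funpow_stabilizes:
  fixes f :: "'b \<Rightarrow> 'b" and \<mu> :: "'b \<Rightarrow> nat"
  assumes "\<And>x. f x \<noteq> x \<Longrightarrow> \<mu> (f x) < \<mu> x"
  shows "f ((f ^^ \<mu> x) x) = (f ^^ \<mu> x) x"
proof (induction "\<mu> x" arbitrary: x rule: less_induct)
  case less
  show ?case
  proof (cases "f x = x")
    case True
    then show ?thesis using funpow_fixed[of f x] by simp
  next
    case False
    from assms[OF this] obtain d where d: "\<mu> x = d + (\<mu> (f x) + 1)"
      by (metis Suc_eq_plus1 Suc_leI add.commute le_Suc_ex)
    let ?y = "(f ^^ \<mu> (f x)) (f x)"
    have "f ?y = ?y" using less assms[OF False] by blast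
    moreover have "(f ^^ \<mu> x) x = (f ^^ d) ?y"
      by (simp add: d funpow_add funpow_swap1)
    ultimately show ?thesis using funpow_fixed[of f ?y d] by simp
  qed
qed

text \<open>The set \<open>X\<close> is not confined to the groups, so a strategy can contribute the
  empty configuration to it. The second clause excludes the empty set as soon as there is a
  group.\<close>

definition stable :: "('c \<Rightarrow> 'c \<Rightarrow> bool) \<Rightarrow> 'c set set \<Rightarrow> 'c set \<Rightarrow> bool" where
  "stable R \<G> X \<longleftrightarrow> (\<forall>c\<in>X. R c c) \<and> (\<forall>g\<in>\<G>. g \<inter> X \<noteq> {}) \<and>
     (\<forall>c\<in>X. \<forall>g\<in>\<G>. \<exists>d\<in>g \<inter> X. R c d)"

text \<open>A configuration that occurs in several groups meets the same fate in all of them, so the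
  effect of \<open>j\<close> rounds is to filter every group by one set.\<close>

primrec survivors :: "('c \<Rightarrow> 'c \<Rightarrow> bool) \<Rightarrow> 'c set set \<Rightarrow> nat \<Rightarrow> 'c set" where
  "survivors R \<G> 0 = {c. R c c}"
| "survivors R \<G> (Suc j) =
     {c \<in> survivors R \<G> j. \<forall>g\<in>\<G>. \<exists>d\<in>g \<inter> survivors R \<G> j. R c d}"

text \<open>Members of \<open>X\<close> answer one another, so none of them is ever the first to be
  deleted.\<close>

lemma stable_subset_survivors: "stable R \<G> X \<Longrightarrow> X \<subseteq> survivors R \<G> j"
  by (induction j) (auto simp: stable_def; blast)+

lemma refine_funpow:
  "(refine ^^ j) (initial_groups k g) = mk (map (\<lambda>grp. mk (filter (\<lambda>c.
     c \<in> survivors consistent ((\<lambda>g. set (ls g)) ` set (ls (groups k g))) j) (ls grp))) (ls (groups k g)))"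
proof (induction j)
  case (Suc j)
  show ?case
    unfolding funpow.simps o_def Suc
    by (auto simp: refine_def Bex_def conj_ac intro!: arg_cong[of _ _ mk] filter_cong)
qed (simp add: initial_groups_def)

lemma length_concat_refine:
  assumes "refine s \<noteq> s"
  shows "length (concat (map ls (ls (refine s)))) < length (concat (map ls (ls s)))"
proof -
  have "length (concat (map ls (map (\<lambda>g. mk (filter P (ls g))) gs))) < length (concat (map ls gs))"
    if "map (\<lambda>g. mk (filter P (ls g))) gs \<noteq> gs" for P gs
    using that
  proof (induction gs)
    case (Cons g gs)
    have le: "length (concat (map ls (map (\<lambda>g. mk (filter P (ls g))) gs))) \<le> length (concat (map ls gs))"
      for gs by (induction gs) (auto intro: add_mono)
    show ?case
    proof (cases "filter P (ls g) = ls g")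
      case True
      then show ?thesis using Cons by auto
    next
      case False
      then have "length (filter P (ls g)) < length (ls g)"
        by (metis filter_True length_filter_less)
      then show ?thesis using le[of gs] by simp
    qed
  qed simp
  moreover have "map (\<lambda>grp. mk (filter (\<lambda>c. \<forall>grp'\<in>set (ls s). \<exists>d\<in>set (ls grp'). consistent c d)
      (ls grp))) (ls s) \<noteq> ls s"
    using assms unfolding refine_def by (metis mk_ls)
  ultimately show ?thesis unfolding refine_def ls_mk by blast
qed

lemma final_groups_nonempty_iff:
  "(\<forall>grp\<in>set (ls (final_groups k g)). grp \<noteq> Leaf) \<longleftrightarrow>
     (\<exists>X. stable consistent ((\<lambda>g. set (ls g)) ` set (ls (groups k g))) X)"
proof -
  define \<G> where "\<G> = (\<lambda>g. set (ls g)) ` set (ls (groups k g))"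
  define n where "n = length (concat (map ls (ls (initial_groups k g))))"
  define A where "A = survivors consistent \<G>"
  have fin: "final_groups k g = mk (map (\<lambda>grp. mk (filter (\<lambda>c. c \<in> A n) (ls grp))) (ls (groups k g)))"
    using refine_funpow[where j = n] by (simp add: final_groups_def A_def \<G>_def n_def)
  have "refine (final_groups k g) = final_groups k g"
    using funpow_stabilizes[of refine "\<lambda>s. length (concat (map ls (ls s)))", OF length_concat_refine]
    by (simp add: final_groups_def)
  moreover have "refine (final_groups k g) =
      mk (map (\<lambda>grp. mk (filter (\<lambda>c. c \<in> A (Suc n)) (ls grp))) (ls (groups k g)))"
    using refine_funpow[where j = "Suc n"] by (simp add: final_groups_def A_def \<G>_def n_def)
  ultimately have "map (\<lambda>grp. mk (filter (\<lambda>c. c \<in> A (Suc n)) (ls grp))) (ls (groups k g)) =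
      map (\<lambda>grp. mk (filter (\<lambda>c. c \<in> A n) (ls grp))) (ls (groups k g))"
    unfolding fin by (metis ls_mk)
  then have eq: "filter (\<lambda>c. c \<in> A (Suc n)) (ls grp) = filter (\<lambda>c. c \<in> A n) (ls grp)"
    if "grp \<in> set (ls (groups k g))" for grp
    using that unfolding map_eq_conv by (metis ls_mk)
  have "c \<in> A (Suc n)" if "c \<in> A n" "c \<in> set (ls grp)" "grp \<in> set (ls (groups k g))" for c grp
  proof -
    have "c \<in> set (filter (\<lambda>c. c \<in> A (Suc n)) (ls grp))"
      unfolding eq[OF that(3)] using that by simp
    then show ?thesis by simp
  qed
  \<comment> \<open>The set \<open>A n\<close> may also contain configurations outside all groups,
    about which the fixed point of \<open>refine\<close> says nothing; hence the restriction to the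
    union of the groups.\<close>
  then have fixed: "c \<in> A (Suc n)" if "c \<in> A n" "c \<in> \<Union>\<G>" for c
    using that unfolding \<G>_def by blast
  have nonempty: "(\<forall>grp\<in>set (ls (final_groups k g)). grp \<noteq> Leaf) \<longleftrightarrow> (\<forall>g\<in>\<G>. g \<inter> A n \<noteq> {})"
    unfolding fin \<G>_def by (auto simp: filter_empty_conv)
  have refl: "A j \<subseteq> {c. consistent c c}" for j
    unfolding A_def by (induction j) auto
  have step: "\<exists>d\<in>g \<inter> A n. consistent c d" if "c \<in> A (Suc n)" "g \<in> \<G>" for c g
    using that unfolding A_def by simp
  have "stable consistent \<G> (A n \<inter> \<Union>\<G>)" if ne: "\<forall>g\<in>\<G>. g \<inter> A n \<noteq> {}"
    unfolding stable_def
  proof (intro conjI ballI)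
    show "consistent c c" if "c \<in> A n \<inter> \<Union>\<G>" for c using that refl by blast
    show "g \<inter> (A n \<inter> \<Union>\<G>) \<noteq> {}" if "g \<in> \<G>" for g using that ne by blast
    show "\<exists>d\<in>g \<inter> (A n \<inter> \<Union>\<G>). consistent c d" if "c \<in> A n \<inter> \<Union>\<G>" "g \<in> \<G>" for c g
      using step[OF fixed[of c] that(2)] that by blast
  qed
  moreover have "\<forall>g\<in>\<G>. g \<inter> A n \<noteq> {}" if "stable consistent \<G> X" for X
  proof
    have "X \<subseteq> A n" unfolding A_def by (rule stable_subset_survivors[OF that])
    moreover fix g assume "g \<in> \<G>"
    then have "g \<inter> X \<noteq> {}" using that by (simp add: stable_def)
    ultimately show "g \<inter> A n \<noteq> {}" by blast
  qed
  ultimately show ?thesis unfolding nonempty \<G>_def[symmetric] by metis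
qed


section \<open>Parsing\<close>

text \<open>The components of a parser state: the bits of the current number, the current list of numbers,
  the current relation, the finished relations of the current structure, the finished structures,
  the universe of the current structure, and the number (0, 1 or 2 in unary) of lists of numbers
  already read among the arities and the current universe. All lists come out reversed, which
  matters neither for the identity of numbers nor for matching the positions of two tuples.\<close>

definition parser_state :: "tree \<Rightarrow> tree \<Rightarrow> tree \<Rightarrow> tree \<Rightarrow> tree \<Rightarrow> tree \<Rightarrow> tree \<Rightarrow> tree" where
  "parser_state n l r s d u m = Node n (Node l (Node r (Node s (Node d (Node u m)))))"

text \<open>Symbol 4 is ambiguous: \<open>m\<close> tells whether the list just ended holds the
  arities, the universe or a tuple. Arities are discarded, as tuples carry their length and
  relations are matched by position. The end of a structure resets \<open>m\<close> to 1, in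
  expectation of the next universe.\<close>

definition parse_with :: "nat \<Rightarrow> tree \<Rightarrow> tree \<Rightarrow> tree \<Rightarrow> tree \<Rightarrow> tree \<Rightarrow> tree \<Rightarrow> tree \<Rightarrow> tree" where
  "parse_with a n l r s d u m =
    (if a = 1 then parser_state (Node Leaf n) l r s d u m
     else if a = 2 then parser_state (Node (Node Leaf Leaf) n) l r s d u m
     else if a = 3 then parser_state Leaf (Node n l) r s d u m
     else if a = 4 then
       (if m = Leaf then parser_state n Leaf r s d u (mk [Leaf])
        else if right m = Leaf then parser_state n Leaf r s d l (mk [Leaf, Leaf])
        else parser_state n Leaf (Node l r) s d u m)
     else if a = 5 then parser_state n l Leaf (Node r s) d u m
     else parser_state n l r Leaf (Node (Node u s) d) Leaf (mk [Leaf]))"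

definition parse :: "nat \<Rightarrow> tree \<Rightarrow> tree" where
  "parse a z = parse_with a (left z) (left (right z)) (left (right (right z)))
     (left (right (right (right z)))) (left (right (right (right (right z)))))
     (left (right (right (right (right (right z)))))) (right (right (right (right (right (right z))))))"

lemma parse_parser_state [simp]:
  "parse a (parser_state n l r s d u m) = parse_with a n l r s d u m"
  by (simp add: parse_def parser_state_def)

lemma feasible_parse: "feasible (parse a)"
  unfolding parse_def parse_with_def parser_state_def
  by (intro feasible_intros feasible_pred_const)

definition start_state :: tree where
  "start_state = parser_state Leaf Leaf Leaf Leaf Leaf Leaf Leaf"

text \<open>The start state has 7 leaves and 6 nodes. The largest growth in one step, 6, occurs at
  the end of a structure.\<close>

lemma tsize_parse: "tsize (fold parse w start_state) \<le> poly [:13, 6:] (length w)"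
proof -
  have step: "\<exists>n' l' r' s' d' u' m'. parse a (parser_state n l r s d u m) =
      parser_state n' l' r' s' d' u' m' \<and>
      tsize (parser_state n' l' r' s' d' u' m') \<le> tsize (parser_state n l r s d u m) + 6"
    for a n l r s d u m
    using tsize_pos[of m] tsize_pos[of u] tsize_pos[of l] tsize_pos[of n]
    unfolding parse_parser_state unfolding parse_with_def by (auto simp: parser_state_def)
  have "tsize (fold parse w (parser_state n l r s d u m)) \<le>
      tsize (parser_state n l r s d u m) + 6 * length w" for n l r s d u m
  proof (induction w arbitrary: n l r s d u m)
    case (Cons a w)
    obtain n' l' r' s' d' u' m' where "parse a (parser_state n l r s d u m) =
        parser_state n' l' r' s' d' u' m'" and
      "tsize (parser_state n' l' r' s' d' u' m') \<le> tsize (parser_state n l r s d u m) + 6"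
      using step[of a n l r s d u m] by (elim exE conjE) (rule that)
    then show ?case using Cons[of n' l' r' s' d' u' m'] by simp
  qed simp
  from this[of Leaf Leaf Leaf Leaf Leaf Leaf Leaf] show ?thesis
    by (simp add: start_state_def) (simp add: parser_state_def)
qed

section \<open>Correctness of the parser\<close>

definition num :: "nat \<Rightarrow> tree" where
  "num n = mk (map bit (rev (bits n)))"

lemma bits_inject: "bits m = bits n \<longleftrightarrow> m = n"
proof
  show "bits m = bits n \<Longrightarrow> m = n"
  proof (induction m arbitrary: n rule: bits.induct)
    case (1 m)
    show ?case
    proof (cases "m = 0 \<or> n = 0")
      case True
      then show ?thesis using 1(2) by (subst (asm) (1 2) bits.simps) (auto split: if_splits)
    next
      case False
      then have "odd m = odd n" "bits (m div 2) = bits (n div 2)"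
        using 1(2) by (subst (asm) (1 2) bits.simps; simp)+
      moreover from this(2) have "m div 2 = n div 2" using 1(1) False by blast
      ultimately show ?thesis by (metis bit_eq_rec dvd_def div_mult_mod_eq even_iff_mod_2_eq_zero odd_iff_mod_2_eq_one)
    qed
  qed
qed simp

lemma same_bits_num: "same_bits (num m) (num n) \<longleftrightarrow> m = n"
  by (simp add: num_def same_bits_iff bits_inject)

definition tuple_tree :: "nat list \<Rightarrow> tree" where
  "tuple_tree xs = mk (map num (rev xs))"

definition rel_tree :: "nat list list \<Rightarrow> tree" where
  "rel_tree r = mk (map tuple_tree (rev r))"

definition rels_tree :: "nat list list list \<Rightarrow> tree" where
  "rels_tree rs = mk (map rel_tree (rev rs))"

lemma parse_nat:
  "fold parse (enc_nat n) (parser_state Leaf (mk l) r s d u m) = parser_state Leaf (mk (num n # l)) r s d u m"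
proof -
  have "fold parse (map (\<lambda>b. if b then 2 else 1) bs) (parser_state (mk x) l r s d u m) =
     parser_state (mk (rev (map bit bs) @ x)) l r s d u m" for bs x l
  proof (induction bs arbitrary: x)
    case (Cons b bs)
    then show ?case using Cons[of "bit b # x"] by (auto simp: parse_with_def bit_def)
  qed simp
  from this[of _ "[]"] show ?thesis
    by (simp add: enc_nat_def num_def parse_with_def rev_map)
qed

lemma parse_nats_body:
  "fold parse (concat (map enc_nat xs)) (parser_state Leaf (mk l) r s d u m) =
     parser_state Leaf (mk (rev (map num xs) @ l)) r s d u m"
  by (induction xs arbitrary: l) (auto simp: parse_nat simp del: mk.simps)

lemma parse_nats_skip:
  "fold parse (enc_nats xs) (parser_state Leaf Leaf r s d u Leaf) =
     parser_state Leaf Leaf r s d u (mk [Leaf])"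
  using parse_nats_body[of xs "[]" r s d u Leaf] by (simp add: enc_nats_def parse_with_def)

lemma parse_nats_universe:
  "fold parse (enc_nats xs) (parser_state Leaf Leaf r s d u (mk [Leaf])) =
     parser_state Leaf Leaf r s d (tuple_tree xs) (mk [Leaf, Leaf])"
  using parse_nats_body[of xs "[]" r s d u "mk [Leaf]"]
  by (simp add: enc_nats_def parse_with_def tuple_tree_def rev_map)

lemma parse_nats_tuple:
  "fold parse (enc_nats xs) (parser_state Leaf Leaf (mk r) s d u (mk [Leaf, Leaf])) =
     parser_state Leaf Leaf (mk (tuple_tree xs # r)) s d u (mk [Leaf, Leaf])"
  using parse_nats_body[of xs "[]" "mk r" s d u "mk [Leaf, Leaf]"]
  by (simp add: enc_nats_def parse_with_def tuple_tree_def rev_map)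

lemma parse_rel:
  "fold parse (enc_rel ts) (parser_state Leaf Leaf Leaf (mk s) d u (mk [Leaf, Leaf])) =
     parser_state Leaf Leaf Leaf (mk (rel_tree ts # s)) d u (mk [Leaf, Leaf])"
proof -
  have "fold parse (concat (map enc_nats ts)) (parser_state Leaf Leaf (mk r) s d u (mk [Leaf, Leaf])) =
     parser_state Leaf Leaf (mk (rev (map tuple_tree ts) @ r)) s d u (mk [Leaf, Leaf])" for r s
    by (induction ts arbitrary: r) (auto simp: parse_nats_tuple simp del: mk.simps)
  from this[of "[]"] show ?thesis
    by (simp add: enc_rel_def parse_with_def rel_tree_def rev_map)
qed

lemma parse_structure:
  "fold parse (enc_structure us rs) (parser_state Leaf Leaf Leaf Leaf d u (mk [Leaf])) =
     parser_state Leaf Leaf Leaf Leaf (Node (Node (tuple_tree us) (rels_tree rs)) d) Leaf (mk [Leaf])"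
proof -
  have "fold parse (concat (map enc_rel rs)) (parser_state Leaf Leaf Leaf (mk s) d u (mk [Leaf, Leaf])) =
     parser_state Leaf Leaf Leaf (mk (rev (map rel_tree rs) @ s)) d u (mk [Leaf, Leaf])" for s u
    by (induction rs arbitrary: s) (auto simp: parse_rel simp del: mk.simps)
  from this[of "[]"] show ?thesis
    by (simp add: enc_structure_def parse_nats_universe parse_with_def rels_tree_def rev_map
        del: mk.simps(2))
qed

lemma parse_pair:
  "fold parse (enc_nats xs @ enc_structure us rs @ enc_structure vs qs) start_state =
     parser_state Leaf Leaf Leaf Leaf
       (mk [Node (tuple_tree vs) (rels_tree qs), Node (tuple_tree us) (rels_tree rs)]) Leaf (mk [Leaf])"
  by (simp add: start_state_def parse_nats_skip parse_structure del: mk.simps(2)) simp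

text \<open>Finished structures are pushed onto \<open>d\<close>, so the second structure comes
  before the first. The first conjunct says that the second universe is non-empty unless the first
  is empty.\<close>

definition duplicator_wins :: "nat \<Rightarrow> tree \<Rightarrow> bool" where
  "duplicator_wins k z \<longleftrightarrow> (case left (right (right (right (right z)))) of d \<Rightarrow>
     (left (left (right d)) = Leaf \<or> left (left d) \<noteq> Leaf) \<and>
     (\<forall>grp\<in>set (ls (final_groups k (pairings (right (left (right d))) (right (left d))))). grp \<noteq> Leaf))"

lemma feasible_duplicator_wins: "feasible_pred (duplicator_wins k)"
  unfolding duplicator_wins_def
  by (intro feasible_intros feasible_comp[OF feasible_final_groups] feasible_pairings)

section \<open>The existential cover game\<close>

lemma hyperedges_subset: "finite_structure \<sigma> A \<Longrightarrow> e \<in> hyperedges \<sigma> A \<Longrightarrow> e \<subseteq> universe A"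
  by (auto simp: finite_structure_def hyperedges_def)

lemma finite_hyperedges:
  assumes "finite_structure \<sigma> A"
  shows "finite (hyperedges \<sigma> A)"
proof (rule finite_subset)
  show "hyperedges \<sigma> A \<subseteq> Pow (universe A)" using hyperedges_subset[OF assms] by blast
  show "finite (Pow (universe A))" using assms by (simp add: finite_structure_def)
qed

lemma weight_le:
  assumes "F \<subseteq> hyperedges \<sigma> A" "finite F" "card F \<le> k" "X \<inter> \<Union>(hyperedges \<sigma> A) \<subseteq> \<Union>F"
  shows "weight \<sigma> A X \<le> k"
proof -
  have "weight \<sigma> A X \<le> card F"
    unfolding weight_def is_union_of_def by (rule Least_le) (use assms in blast)
  then show ?thesis using assms(3) by simp
qed

text \<open>The finitely many hyperedges together cover every set, so the least number in
  \<open>weight\<close> is attained.\<close>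

lemma weight_cover:
  assumes "finite_structure \<sigma> A" "weight \<sigma> A X \<le> k"
  obtains F where "F \<subseteq> hyperedges \<sigma> A" "finite F" "card F \<le> k" "X \<inter> \<Union>(hyperedges \<sigma> A) \<subseteq> \<Union>F"
proof -
  have "\<exists>n U. is_union_of \<sigma> A n U \<and> X \<inter> \<Union>(hyperedges \<sigma> A) \<subseteq> U"
    unfolding is_union_of_def using finite_hyperedges[OF assms(1)] by blast
  then have "\<exists>U. is_union_of \<sigma> A (weight \<sigma> A X) U \<and> X \<inter> \<Union>(hyperedges \<sigma> A) \<subseteq> U"
    unfolding weight_def by (rule LeastI_ex)
  then obtain F where "F \<subseteq> hyperedges \<sigma> A" "finite F" "card F = weight \<sigma> A X"
    "X \<inter> \<Union>(hyperedges \<sigma> A) \<subseteq> \<Union>F"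
    unfolding is_union_of_def by (elim exE conjE) simp
  then show ?thesis using that[of F] assms(2) by simp
qed

text \<open>The elements of \<open>W\<close> are added one at a time; the same \<open>F\<close>
  covers every domain on the way, so each weight stays within \<open>k\<close>.\<close>

lemma winning_strategy_extend:
  assumes H: "winning_strategy k \<sigma> A B H" and F: "F \<subseteq> hyperedges \<sigma> A" "finite F" "card F \<le> k"
    and W: "finite W" "W \<subseteq> universe A" "W \<inter> \<Union>(hyperedges \<sigma> A) \<subseteq> \<Union>F"
  shows "h \<in> H \<Longrightarrow> dom h \<subseteq> W \<Longrightarrow> \<exists>h'\<in>H. h \<subseteq>\<^sub>m h' \<and> dom h' = W"
proof (induction "card (W - dom h)" arbitrary: h)
  case 0
  then have "dom h = W" using W by auto
  then show ?case using 0 by (intro bexI[of _ h]) auto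
next
  case (Suc n)
  then obtain a where a: "a \<in> W - dom h" by (metis card.empty equals0I nat.distinct(1))
  then have "weight \<sigma> A (dom h \<union> {a}) \<le> k"
    by (intro weight_le[OF F]) (use Suc.prems W in blast)
  moreover have "a \<in> universe A - dom h" using a W by blast
  ultimately obtain h1 where h1: "h1 \<in> H" "h \<subseteq>\<^sub>m h1" "dom h1 = dom h \<union> {a}"
    using H Suc.prems(1) unfolding winning_strategy_def by meson
  have "W - dom h1 = (W - dom h) - {a}" using h1(3) by blast
  then have "n = card (W - dom h1)" using Suc.hyps(2) a W by simp
  then obtain h' where "h' \<in> H" "h1 \<subseteq>\<^sub>m h'" "dom h' = W"
    using Suc.hyps(1)[of h1] h1 Suc.prems a by auto
  then show ?case using map_le_trans[OF h1(2)] by blast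
qed

section \<open>Configurations chosen from a tuple of groups\<close>

primrec choice_group :: "'b list list list \<Rightarrow> 'b list list" where
  "choice_group [] = [[]]"
| "choice_group (x # xs) = concat (map (\<lambda>p. map (\<lambda>c. p @ c) (choice_group xs)) x)"

lemma set_choices: "set (choices k gs) = choice_group ` {xs. length xs = k \<and> set xs \<subseteq> set gs}"
proof (induction k)
  case (Suc k)
  have "{xs. length xs = Suc k \<and> set xs \<subseteq> set gs} =
      (\<Union>x\<in>set gs. (#) x ` {xs. length xs = k \<and> set xs \<subseteq> set gs})"
    by (auto simp: length_Suc_conv image_iff)
  then show ?case using Suc by (simp add: image_UN image_image)
qed auto

lemma choice_groupI:
  "(\<And>x. x \<in> set xs \<Longrightarrow> f x \<in> set x) \<Longrightarrow> \<exists>c\<in>set (choice_group xs). set c = (\<Union>x\<in>set xs. set (f x))"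
proof (induction xs)
  case (Cons x xs)
  then obtain c where "c \<in> set (choice_group xs)" "set c = (\<Union>x\<in>set xs. set (f x))" by auto
  moreover from this have "f x @ c \<in> set (choice_group (x # xs))" using Cons.prems[of x] by auto
  ultimately show ?case by (intro bexI[of _ "f x @ c"]) auto
qed simp

lemma choice_groupD:
  "c \<in> set (choice_group xs) \<Longrightarrow> x \<in> set xs \<Longrightarrow> \<exists>p\<in>set x. set p \<subseteq> set c"
proof (induction xs arbitrary: c)
  case (Cons y xs)
  then obtain p d where pd: "p \<in> set y" "d \<in> set (choice_group xs)" "c = p @ d" by auto
  show ?case
  proof (cases "x = y")
    case True
    then show ?thesis using pd by (intro bexI[of _ p]) auto
  next
    case False
    then obtain q where "q \<in> set x" "set q \<subseteq> set d" using Cons.IH[OF pd(2)] Cons.prems by auto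
    then show ?thesis using pd by (intro bexI[of _ q]) auto
  qed
qed simp

section \<open>Equivalence of winning strategies and stable sets\<close>

definition agree :: "('a \<times> 'b) list \<Rightarrow> ('a \<times> 'b) list \<Rightarrow> bool" where
  "agree c d \<longleftrightarrow> (\<forall>p\<in>set c. \<forall>q\<in>set d. fst p = fst q \<longrightarrow> snd p = snd q)"

text \<open>Comparing sets of pairs hides the order of the listings and the reversal of tuples by
  the parser.\<close>

definition images_of :: "('s, 'b) rel_structure \<Rightarrow> 's \<Rightarrow> 'a list \<Rightarrow> ('a \<times> 'b) list list \<Rightarrow> bool" where
  "images_of B R t g \<longleftrightarrow> set ` set g = (\<lambda>s. set (zip t s)) ` rel B R"

locale cover_game =
  fixes k :: nat and \<sigma> :: "'s signature" and A :: "('s, 'a) rel_structure"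
    and B :: "('s, 'b) rel_structure" and gs :: "('a \<times> 'b) list list list"
  assumes k: "k \<ge> 1" and A: "finite_structure \<sigma> A" and B: "finite_structure \<sigma> B"
    and sound: "\<And>g. g \<in> set gs \<Longrightarrow> \<exists>R\<in>symbols \<sigma>. \<exists>t\<in>rel A R. images_of B R t g"
    and complete: "\<And>R t. R \<in> symbols \<sigma> \<Longrightarrow> t \<in> rel A R \<Longrightarrow> \<exists>g\<in>set gs. images_of B R t g"
begin

lemma length_A: "R \<in> symbols \<sigma> \<Longrightarrow> t \<in> rel A R \<Longrightarrow> length t = arity \<sigma> R"
  using A by (simp add: finite_structure_def)

lemma length_B: "R \<in> symbols \<sigma> \<Longrightarrow> s \<in> rel B R \<Longrightarrow> length s = arity \<sigma> R"
  using B by (simp add: finite_structure_def)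

text \<open>The domain of \<open>h\<close> together with the chosen tuples may have weight above
  \<open>k\<close>, so \<open>h\<close> is first restricted to their union \<open>U\<close> and then
  extended to all of \<open>U\<close>. Projectivity of the extension supplies an image tuple for
  each of them. Agreement with \<open>h\<close> survives the restriction because the answer is
  defined on \<open>U\<close> only.\<close>

lemma strategy_answers:
  assumes H: "winning_strategy k \<sigma> A B H" and h: "h \<in> H"
    and xs: "length xs = k" "set xs \<subseteq> set gs"
  shows "\<exists>c\<in>set (choice_group xs). \<exists>h'\<in>H. (\<forall>(x, y)\<in>set c. h' x = Some y) \<and>
    (\<forall>(x, y)\<in>set c. \<forall>z. h x = Some z \<longrightarrow> z = y)"
proof -
  have "\<forall>x\<in>set xs. \<exists>R t. R \<in> symbols \<sigma> \<and> t \<in> rel A R \<and> images_of B R t x"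
    using sound xs by blast
  then obtain R t where Rt: "\<And>x. x \<in> set xs \<Longrightarrow> R x \<in> symbols \<sigma> \<and> t x \<in> rel A (R x) \<and> images_of B (R x) (t x) x"
    by metis
  define F where "F = (\<lambda>x. set (t x)) ` set xs"
  define U where "U = \<Union>F"
  have F: "F \<subseteq> hyperedges \<sigma> A" "finite F" using Rt by (auto simp: F_def hyperedges_def)
  have cardF: "card F \<le> k"
    unfolding F_def using card_image_le[of "set xs"] card_length[of xs] xs(1) le_trans by blast
  have U: "finite U" "U \<subseteq> universe A" "U \<inter> \<Union>(hyperedges \<sigma> A) \<subseteq> \<Union>F"
    using hyperedges_subset[OF A] F by (auto simp: U_def F_def)
  have "h |` U \<in> H"
    using H h unfolding winning_strategy_def by (auto simp: map_le_def)
  then obtain h' where h': "h' \<in> H" "h |` U \<subseteq>\<^sub>m h'" "dom h' = U"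
    using winning_strategy_extend[OF H F cardF U, of "h |` U"] by auto
  have "\<exists>p\<in>set x. \<forall>(a, b)\<in>set p. h' a = Some b \<and> a \<in> U" if x: "x \<in> set xs" for x
  proof -
    note r = Rt[OF x]
    have "projective_hom \<sigma> A B h'" using H h'(1) by (simp add: winning_strategy_def)
    then obtain s where s: "s \<in> rel B (R x)"
      "\<And>i. i < arity \<sigma> (R x) \<Longrightarrow> t x ! i \<in> dom h' \<Longrightarrow> h' (t x ! i) = Some (s ! i)"
      unfolding projective_hom_def using r by meson
    have tU: "set (t x) \<subseteq> U" using x by (auto simp: U_def F_def)
    have "\<forall>(a, b)\<in>set (zip (t x) s). h' a = Some b \<and> a \<in> U"
    proof -
      have "h' (t x ! i) = Some (s ! i) \<and> t x ! i \<in> U" if i: "i < length (t x)" for i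
      proof -
        have "t x ! i \<in> U" using i tU by auto
        then show ?thesis using s(2)[of i] i r length_A h'(3) by auto
      qed
      then show ?thesis by (auto simp: set_zip)
    qed
    moreover obtain p where "p \<in> set x" "set p = set (zip (t x) s)"
      using r s(1) unfolding images_of_def by (metis (no_types, lifting) imageE imageI)
    ultimately show ?thesis by blast
  qed
  then have "\<forall>x\<in>set xs. \<exists>p. p \<in> set x \<and> (\<forall>(a, b)\<in>set p. h' a = Some b \<and> a \<in> U)" by blast
  from bchoice[OF this] obtain f where f: "\<forall>x\<in>set xs. f x \<in> set x \<and> (\<forall>(a, b)\<in>set (f x). h' a = Some b \<and> a \<in> U)"
    ..
  obtain c where c: "c \<in> set (choice_group xs)" "set c = (\<Union>x\<in>set xs. set (f x))"
    using choice_groupI[of xs f] f by blast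
  have graph: "h' a = Some b \<and> a \<in> U" if "(a, b) \<in> set c" for a b
    using that f unfolding c(2) by fastforce
  have "z = b" if ab: "(a, b) \<in> set c" and z: "h a = Some z" for a b z
  proof -
    have "(h |` U) a = Some z" using graph[OF ab] z by simp
    then have "h' a = Some z" using h'(2) unfolding map_le_def by (metis domI)
    then show ?thesis using graph[OF ab] by simp
  qed
  then show ?thesis using c(1) h'(1) graph by (intro bexI[of _ c] bexI[of _ h']) auto
qed

text \<open>A single element has weight at most 1, hence at most \<open>k\<close>, so the Duplicator
  must be able to place it starting from the empty map.\<close>

lemma strategy_imp_universe:
  assumes H: "winning_strategy k \<sigma> A B H"
  shows "universe A = {} \<or> universe B \<noteq> {}"
proof (rule ccontr)
  assume "\<not> ?thesis"
  then obtain a where a: "a \<in> universe A" and empty: "universe B = {}" by blast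
  obtain h where "h \<in> H" using H unfolding winning_strategy_def by blast
  then have h: "Map.empty \<in> H" using H unfolding winning_strategy_def by simp
  obtain F where F: "F \<subseteq> hyperedges \<sigma> A" "finite F" "card F \<le> k" "{a} \<inter> \<Union>(hyperedges \<sigma> A) \<subseteq> \<Union>F"
  proof (cases "a \<in> \<Union>(hyperedges \<sigma> A)")
    case True
    then obtain e where "e \<in> hyperedges \<sigma> A" "a \<in> e" by blast
    then show ?thesis using that[of "{e}"] k by auto
  next
    case False
    then show ?thesis using that[of "{}"] by auto
  qed
  obtain h' where h': "h' \<in> H" "dom h' = {a}"
    using winning_strategy_extend[OF H F(1-3) _ _ F(4) h] a by auto
  then have "ran h' \<subseteq> universe B"
    using H unfolding winning_strategy_def projective_hom_def by blast
  then show False using h'(2) empty by (metis domD insertI1 ranI subset_empty empty_iff)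
qed

lemma strategy_imp_stable:
  assumes H: "winning_strategy k \<sigma> A B H"
  shows "\<exists>X. stable agree (set ` set (choices k gs)) X"
proof -
  define X where "X = {c :: ('a \<times> 'b) list. \<exists>h\<in>H. \<forall>(x, y)\<in>set c. h x = Some y}"
  have answer: "\<exists>d\<in>set (choice_group xs) \<inter> X. agree c d"
    if c: "c \<in> X" and xs: "length xs = k" "set xs \<subseteq> set gs" for c xs
  proof -
    obtain h where h: "h \<in> H" "\<And>x y. (x, y) \<in> set c \<Longrightarrow> h x = Some y"
      using c unfolding X_def by blast
    obtain d h' where d: "d \<in> set (choice_group xs)" "h' \<in> H" "\<forall>(x, y)\<in>set d. h' x = Some y"
      "\<forall>(x, y)\<in>set d. \<forall>z. h x = Some z \<longrightarrow> z = y"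
      using strategy_answers[OF H h(1) xs] by blast
    have "agree c d" unfolding agree_def using d(4) h(2) by fastforce
    then show ?thesis using d unfolding X_def by blast
  qed
  \<comment> \<open>Answers to the empty configuration show that every group meets
    \<open>X\<close>.\<close>
  have empty: "[] \<in> X" using H unfolding X_def winning_strategy_def by auto
  have 1: "agree c c" if "c \<in> X" for c
  proof -
    from that obtain h where h: "\<forall>(x, y)\<in>set c. h x = Some y"
      unfolding X_def by auto
    have "y = z" if "(x, y) \<in> set c" "(x, z) \<in> set c" for x y z
      using bspec[OF h that(1)] bspec[OF h that(2)] by simp
    then show ?thesis unfolding agree_def by auto
  qed
  have 2: "g \<inter> X \<noteq> {}" if "g \<in> set ` set (choices k gs)" for g
    using that answer[OF empty] unfolding set_choices by (auto; blast)
  have 3: "\<exists>d\<in>g \<inter> X. agree c d" if "c \<in> X" "g \<in> set ` set (choices k gs)" for c g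
    using that(2) answer[OF that(1)] unfolding set_choices by (auto; blast)
  show ?thesis unfolding stable_def by (intro exI[of _ X] conjI ballI 1 2 3)
qed

lemma stable_imp_strategy:
  assumes X: "stable agree (set ` set (choices k gs)) X"
    and universe: "universe A = {} \<or> universe B \<noteq> {}"
  shows "\<exists>H. winning_strategy k \<sigma> A B H"
proof -
  define E where "E = \<Union>(hyperedges \<sigma> A)"
  \<comment> \<open>Only the values on elements of hyperedges are tied to a witness
    \<open>c\<close>; elsewhere they are arbitrary in \<open>B\<close>. Inserting \<open>[]\<close>
    admits the empty map even when \<open>X\<close> is empty, as may happen if \<open>A\<close> has
    no tuples.\<close>
  define H where "H = {h. dom h \<subseteq> universe A \<and> ran h \<subseteq> universe B \<and>
    (\<exists>c\<in>insert [] X. \<forall>x\<in>dom h \<inter> E. \<exists>y. (x, y) \<in> set c \<and> h x = Some y)}"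
  have stable_meets: "g \<inter> X \<noteq> {}" if "g \<in> set ` set (choices k gs)" for g
    using X that by (auto simp: stable_def)
  have stable_answer: "\<exists>d\<in>g \<inter> X. agree c d" if "c \<in> X" "g \<in> set ` set (choices k gs)" for c g
    using X that by (auto simp: stable_def)
  have answer: "\<exists>d\<in>set (choice_group xs) \<inter> X. agree c d"
    if "c \<in> insert [] X" "length xs = k" "set xs \<subseteq> set gs" for c xs
  proof -
    have g: "set (choice_group xs) \<in> set ` set (choices k gs)"
      using that(2,3) unfolding set_choices by blast
    show ?thesis
    proof (cases "c \<in> X")
      case True
      then show ?thesis using stable_answer g by blast
    next
      case False
      then have "agree c d" for d using that(1) by (simp add: agree_def)
      then show ?thesis using stable_meets[OF g] by blast
    qed
  qed
  have "Map.empty \<in> H" unfolding H_def by auto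
  moreover have "projective_hom \<sigma> A B h" if "h \<in> H" for h
    unfolding projective_hom_def
  proof (intro conjI ballI)
    show "dom h \<subseteq> universe A" "ran h \<subseteq> universe B" using that by (auto simp: H_def)
    fix R t assume R: "R \<in> symbols \<sigma>" and t: "t \<in> rel A R"
    obtain c where c: "c \<in> insert [] X" "\<And>x. x \<in> dom h \<inter> E \<Longrightarrow> \<exists>y. (x, y) \<in> set c \<and> h x = Some y"
      using \<open>h \<in> H\<close> unfolding H_def by blast
    obtain g where g: "g \<in> set gs" "images_of B R t g" using complete[OF R t] by blast
    \<comment> \<open>Since \<open>k\<close> is positive, the answer to \<open>k\<close> copies of
      \<open>g\<close> contains an image of \<open>t\<close>. Its agreement with \<open>c\<close>
      forces the values of \<open>h\<close> on \<open>t\<close> to be entries of that image.\<close>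
    have "set (replicate k g) \<subseteq> set gs" using g(1) by auto
    from answer[OF c(1) length_replicate this]
    obtain d where d: "d \<in> set (choice_group (replicate k g))" "agree c d" by blast
    obtain p where p: "p \<in> set g" "set p \<subseteq> set d"
      using choice_groupD[OF d(1), of g] k by auto
    then obtain s where s: "s \<in> rel B R" "set p = set (zip t s)"
      using g(2) unfolding images_of_def by (metis (no_types, lifting) imageE imageI)
    have "h (t ! i) = Some (s ! i)" if i: "i < arity \<sigma> R" "t ! i \<in> dom h" for i
    proof -
      have "set t \<in> hyperedges \<sigma> A" unfolding hyperedges_def using R t by blast
      moreover have "t ! i \<in> set t" using i length_A[OF R t] by simp
      ultimately have "t ! i \<in> E" unfolding E_def by blast
      then obtain y where y: "(t ! i, y) \<in> set c" "h (t ! i) = Some y" using c(2) i by blast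
      have "(t ! i, s ! i) \<in> set d"
        using p(2) s i length_A[OF R t] length_B[OF R s(1)] by (auto simp: set_zip)
      then have "y = s ! i" using d(2) y(1) unfolding agree_def by fastforce
      with y show ?thesis by simp
    qed
    then show "\<exists>s\<in>rel B R. \<forall>i<arity \<sigma> R. t ! i \<in> dom h \<longrightarrow> h (t ! i) = Some (s ! i)"
      using s(1) by blast
  qed
  moreover have "h' \<in> H" if "h \<in> H" "h' \<subseteq>\<^sub>m h" for h h'
  proof -
    have eq: "h' x = h x" if "x \<in> dom h'" for x
      using \<open>h' \<subseteq>\<^sub>m h\<close> that unfolding map_le_def by blast
    have dom: "dom h' \<subseteq> dom h" using map_le_implies_dom_le[OF \<open>h' \<subseteq>\<^sub>m h\<close>] .
    have ran: "ran h' \<subseteq> ran h"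
    proof
      fix b assume "b \<in> ran h'"
      then obtain x where "h' x = Some b" by (auto simp: ran_def)
      then have "h x = Some b" using eq[of x] by (simp add: domI)
      then show "b \<in> ran h" by (rule ranI)
    qed
    obtain c where c: "c \<in> insert [] X" "\<And>x. x \<in> dom h \<inter> E \<Longrightarrow> \<exists>y. (x, y) \<in> set c \<and> h x = Some y"
      using \<open>h \<in> H\<close> unfolding H_def by blast
    have "\<exists>y. (x, y) \<in> set c \<and> h' x = Some y" if "x \<in> dom h' \<inter> E" for x
      using c(2)[of x] that dom eq[of x] by auto
    then show ?thesis
      using \<open>h \<in> H\<close> c(1) dom ran unfolding H_def by blast
  qed
  moreover have "\<exists>h'\<in>H. h \<subseteq>\<^sub>m h' \<and> dom h' = dom h \<union> {a}"
    if h: "h \<in> H" and a: "a \<in> universe A - dom h" and w: "weight \<sigma> A (dom h \<union> {a}) \<le> k" for h a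
  proof -
    obtain c where c: "c \<in> insert [] X" "\<And>x. x \<in> dom h \<inter> E \<Longrightarrow> \<exists>y. (x, y) \<in> set c \<and> h x = Some y"
      using h unfolding H_def by blast
    have ext: "h \<subseteq>\<^sub>m h(a \<mapsto> b) \<and> dom (h(a \<mapsto> b)) = dom h \<union> {a}" for b
      using a by (auto simp: map_le_def)
    have bounds: "dom (h(a \<mapsto> b)) \<subseteq> universe A \<and> ran (h(a \<mapsto> b)) \<subseteq> universe B"
      if "b \<in> universe B" for b
      using h a that unfolding H_def by (auto simp: ran_def split: if_splits)
    show ?thesis
    proof (cases "a \<in> E")
      case False
      \<comment> \<open>The witness \<open>c\<close> is kept: outside all hyperedges any value will
        do.\<close>
      obtain b where b: "b \<in> universe B" using universe a by blast
      have "h(a \<mapsto> b) \<in> H"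
        unfolding H_def using bounds[OF b] c False
        by (intro CollectI conjI bexI[of _ c]) auto
      then show ?thesis using ext by blast
    next
      case True
      obtain F where F: "F \<subseteq> hyperedges \<sigma> A" "finite F" "card F \<le> k" "(dom h \<union> {a}) \<inter> E \<subseteq> \<Union>F"
        using weight_cover[OF A w] unfolding E_def by blast
      have "\<forall>e\<in>F. \<exists>R t g. R \<in> symbols \<sigma> \<and> t \<in> rel A R \<and> e = set t \<and> g \<in> set gs \<and> images_of B R t g"
        using F(1) complete unfolding hyperedges_def by blast
      then obtain R t g where Rtg: "\<And>e. e \<in> F \<Longrightarrow> R e \<in> symbols \<sigma> \<and> t e \<in> rel A (R e) \<and>
          e = set (t e) \<and> g e \<in> set gs \<and> images_of B (R e) (t e) (g e)"
        by metis
      have "F \<noteq> {}" using F(4) True by blast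
      moreover obtain es where es: "set es = F" "length es = card F"
        using F(2) by (metis distinct_card finite_distinct_list)
      ultimately have "es \<noteq> []" by auto
      \<comment> \<open>Groups come from exactly \<open>k\<close> tuples, whereas the cover may be
        smaller; it is padded with its first hyperedge, which exists because \<open>a\<close> has to
        be covered.\<close>
      define fs where "fs = es @ replicate (k - length es) (hd es)"
      have fs: "set fs = F" "length fs = k"
        using es F(3) \<open>es \<noteq> []\<close> by (auto simp: fs_def hd_in_set)
      define xs where "xs = map g fs"
      have xs: "length xs = k" "set xs \<subseteq> set gs" using fs Rtg by (auto simp: xs_def)
      obtain d where d: "d \<in> set (choice_group xs)" "d \<in> X" "agree c d"
        using answer[OF c(1) xs] by blast
      have cover: "\<exists>y\<in>universe B. (x, y) \<in> set d" if x: "x \<in> (dom h \<union> {a}) \<inter> E" for x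
      proof -
        have "x \<in> \<Union>F" using F(4) x by (rule subsetD)
        then obtain e where e: "e \<in> F" "x \<in> e" by blast
        note r = Rtg[OF e(1)]
        have "g e \<in> set xs" using e(1) fs by (simp add: xs_def)
        then obtain p where p: "p \<in> set (g e)" "set p \<subseteq> set d" using choice_groupD[OF d(1)] by blast
        then obtain s where s: "s \<in> rel B (R e)" "set p = set (zip (t e) s)"
          using r unfolding images_of_def by (metis (no_types, lifting) imageE imageI)
        have len: "length (t e) = length s" using r s(1) length_A length_B by metis
        obtain i where i: "i < length (t e)" "x = t e ! i"
          using r e(2) by (metis in_set_conv_nth)
        have "(x, s ! i) \<in> set d" using p(2) s(2) i len by (auto simp: set_zip)
        moreover have "s ! i \<in> universe B"
          using B r s(1) i len unfolding finite_structure_def by (metis nth_mem subsetD)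
        ultimately show ?thesis by blast
      qed
      obtain b where b: "b \<in> universe B" "(a, b) \<in> set d" using cover[of a] True by blast
      \<comment> \<open>The witness changes from \<open>c\<close> to \<open>d\<close>, which is
        defined on the whole new domain inside \<open>E\<close> and repeats the values of
        \<open>h\<close> there by agreement with \<open>c\<close>.\<close>
      have "\<exists>y. (x, y) \<in> set d \<and> (h(a \<mapsto> b)) x = Some y" if x: "x \<in> dom (h(a \<mapsto> b)) \<inter> E" for x
      proof (cases "x = a")
        case True
        then show ?thesis using b by auto
      next
        case False
        then have "x \<in> dom h \<inter> E" using x by auto
        then obtain y where y: "(x, y) \<in> set c" "h x = Some y" using c(2) by blast
        obtain z where z: "(x, z) \<in> set d" using cover[of x] \<open>x \<in> dom h \<inter> E\<close> by blast
        then have "y = z" using d(3) y(1) unfolding agree_def by fastforce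
        then show ?thesis using y z False by auto
      qed
      then have "h(a \<mapsto> b) \<in> H"
        unfolding H_def using bounds[OF b(1)] d(2) by blast
      then show ?thesis using ext by blast
    qed
  qed
  ultimately have "winning_strategy k \<sigma> A B H"
    unfolding winning_strategy_def by blast
  then show ?thesis by blast
qed

theorem winning_strategy_iff_stable:
  "(\<exists>H. winning_strategy k \<sigma> A B H) \<longleftrightarrow>
     (universe A = {} \<or> universe B \<noteq> {}) \<and> (\<exists>X. stable agree (set ` set (choices k gs)) X)"
  using strategy_imp_universe strategy_imp_stable stable_imp_strategy by blast

end

section \<open>Correctness of the decision procedure\<close>

lemma set_enc_nat: "set (enc_nat n) \<subseteq> {1..<7}"
  by (auto simp: enc_nat_def)

lemma set_enc_nats: "set (enc_nats xs) \<subseteq> {1..<7}"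
  using set_enc_nat by (fastforce simp: enc_nats_def)

lemma set_enc_rel: "set (enc_rel ts) \<subseteq> {1..<7}"
  using set_enc_nats by (fastforce simp: enc_rel_def)

lemma set_enc_structure: "set (enc_structure us rs) \<subseteq> {1..<7}"
  using set_enc_nats[of us] set_enc_rel by (fastforce simp: enc_structure_def)

section \<open>Transfer from trees to lists of pairs\<close>

definition pair_tree :: "nat \<times> nat \<Rightarrow> tree" where
  "pair_tree p = Node (num (fst p)) (num (snd p))"

definition config_tree :: "(nat \<times> nat) list \<Rightarrow> tree" where
  "config_tree c = mk (map pair_tree c)"

lemma consistent_config_tree: "consistent (config_tree c) (config_tree d) \<longleftrightarrow> agree c d"
  by (simp add: consistent_def agree_def config_tree_def pair_tree_def same_bits_num)

text \<open>The reversals mirror the output of the parser, so that \<open>pairings_rels_tree\<close>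
  is an equality and not merely true up to order.\<close>

definition answers :: "nat list list list \<Rightarrow> nat list list list \<Rightarrow> (nat \<times> nat) list list list" where
  "answers rs qs = concat (map (\<lambda>(r, q). map (\<lambda>t. map (\<lambda>s. zip (rev t) (rev s)) (rev q)) (rev r))
     (zip (rev rs) (rev qs)))"

lemma map2_Node_tuple_tree:
  "mk (map2 Node (ls (tuple_tree t)) (ls (tuple_tree s))) = config_tree (zip (rev t) (rev s))"
  by (simp add: tuple_tree_def config_tree_def pair_tree_def[abs_def] zip_map_map split_def o_def)

lemma pairings_rels_tree:
  "pairings (rels_tree rs) (rels_tree qs) = mk (map (\<lambda>g. mk (map config_tree g)) (answers rs qs))"
proof -
  have inner: "map (\<lambda>x. mk (map (\<lambda>y. mk (map2 Node (ls x) (ls y))) (ls (rel_tree q)))) (ls (rel_tree r)) =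
      map (\<lambda>g. mk (map config_tree g)) (map (\<lambda>t. map (\<lambda>s. zip (rev t) (rev s)) (rev q)) (rev r))" for r q
    by (simp add: rel_tree_def o_def map2_Node_tuple_tree)
  show ?thesis
    unfolding pairings_def answers_def
    by (simp add: rels_tree_def zip_map_map split_def map_concat o_def inner[unfolded split_def o_def map_map])
qed

lemma choices_map: "choices k (map (map (map f)) g) = map (map (map f)) (choices k g)"
  by (induction k) (simp_all add: map_concat o_def)

lemma groups_config_tree:
  "groups k (mk (map (\<lambda>g. mk (map config_tree g)) gs)) =
     mk (map (\<lambda>g. mk (map config_tree g)) (choices k gs))"
  using groups_mk[of k "map (map (map pair_tree)) gs"]
  by (simp add: choices_map o_def config_tree_def[abs_def])

text \<open>A stable set is transported by preimage in one direction and by image in the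
  other.\<close>

lemma stable_image:
  assumes "\<And>c d. R' (f c) (f d) \<longleftrightarrow> R c d"
  shows "(\<exists>X. stable R' ((`) f ` \<G>) X) \<longleftrightarrow> (\<exists>X. stable R \<G> X)"
proof
  assume "\<exists>X. stable R' ((`) f ` \<G>) X"
  then obtain X where X: "stable R' ((`) f ` \<G>) X" ..
  have 1: "R c c" if "c \<in> f -` X" for c
    using X that assms unfolding stable_def by auto
  have 2: "g \<inter> f -` X \<noteq> {}" if "g \<in> \<G>" for g
  proof -
    have "f ` g \<inter> X \<noteq> {}" using X that unfolding stable_def by simp
    then show ?thesis by blast
  qed
  have 3: "\<exists>d\<in>g \<inter> f -` X. R c d" if "c \<in> f -` X" "g \<in> \<G>" for c g
  proof -
    have "\<exists>d\<in>f ` g \<inter> X. R' (f c) d" using X that unfolding stable_def by simp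
    then show ?thesis using assms by blast
  qed
  show "\<exists>X. stable R \<G> X"
    unfolding stable_def by (intro exI[of _ "f -` X"] conjI ballI 1 2 3)
next
  assume "\<exists>X. stable R \<G> X"
  then obtain X where X: "stable R \<G> X" ..
  have 1: "R' c c" if "c \<in> f ` X" for c
    using X that assms unfolding stable_def by auto
  have 2: "g \<inter> f ` X \<noteq> {}" if g: "g \<in> (`) f ` \<G>" for g
  proof -
    obtain g' where g': "g' \<in> \<G>" "g = f ` g'" using g by blast
    then have "g' \<inter> X \<noteq> {}" using X unfolding stable_def by simp
    then show ?thesis using g'(2) by blast
  qed
  have 3: "\<exists>d\<in>g \<inter> f ` X. R' c d" if c: "c \<in> f ` X" and g: "g \<in> (`) f ` \<G>" for c g
  proof -
    obtain c' g' where c': "c' \<in> X" "c = f c'" and g': "g' \<in> \<G>" "g = f ` g'" using c g by blast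
    then have "\<exists>d\<in>g' \<inter> X. R c' d" using X unfolding stable_def by simp
    then show ?thesis using c'(2) g'(2) assms by blast
  qed
  show "\<exists>X. stable R' ((`) f ` \<G>) X"
    unfolding stable_def by (intro exI[of _ "f ` X"] conjI ballI 1 2 3)
qed

lemma cover_game_answers:
  assumes k: "k \<ge> 1" and A: "finite_structure \<sigma> A" and B: "finite_structure \<sigma> B"
    and ss: "listing ss (symbols \<sigma>)"
    and rs: "list_all2 (\<lambda>r R. listing r (rel A R)) rs ss"
    and qs: "list_all2 (\<lambda>r R. listing r (rel B R)) qs ss"
  shows "cover_game k \<sigma> A B (answers rs qs)"
proof
  have len: "length rs = length ss" "length qs = length ss"
    using rs qs by (auto dest: list_all2_lengthD)
  have nth: "set (rs ! i) = rel A (ss ! i)" "set (qs ! i) = rel B (ss ! i)" "ss ! i \<in> symbols \<sigma>"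
    if "i < length ss" for i
    using that list_all2_nthD2[OF rs that] list_all2_nthD2[OF qs that] ss by (auto simp: listing_def)
  have images: "images_of B (ss ! i) t (map (\<lambda>s. zip (rev t) (rev s)) (rev (qs ! i)))"
    if i: "i < length ss" and t: "t \<in> rel A (ss ! i)" for i t
  proof -
    have "length t = length s" if "s \<in> rel B (ss ! i)" for s
      using A B nth(3)[OF i] t that unfolding finite_structure_def by simp
    \<comment> \<open>Reversing both tuples keeps positions matched because their lengths are equal,
      namely the common arity.\<close>
    then have "set (zip (rev t) (rev s)) = set (zip t s)" if "s \<in> rel B (ss ! i)" for s
      using that by (simp add: zip_rev)
    then show ?thesis
      unfolding images_of_def using nth(2)[OF i] by (simp add: image_image)
  qed
  have set_answers: "set (answers rs qs) =
      (\<Union>i<length ss. \<Union>t\<in>rel A (ss ! i). {map (\<lambda>s. zip (rev t) (rev s)) (rev (qs ! i))})"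
  proof -
    have "set (zip (rev rs) (rev qs)) = (\<lambda>i. (rs ! i, qs ! i)) ` {..<length ss}"
      using len by (auto simp: zip_rev set_zip)
    then show ?thesis using nth(1) by (auto simp: answers_def)
  qed
  show "\<exists>R\<in>symbols \<sigma>. \<exists>t\<in>rel A R. images_of B R t g" if "g \<in> set (answers rs qs)" for g
    using that images nth(3) unfolding set_answers by blast
  show "\<exists>g\<in>set (answers rs qs). images_of B R t g" if "R \<in> symbols \<sigma>" "t \<in> rel A R" for R t
  proof -
    have "R \<in> set ss" using that(1) ss by (simp add: listing_def)
    then obtain i where i: "i < length ss" "R = ss ! i" by (auto simp: in_set_conv_nth)
    show ?thesis
    proof (rule bexI)
      show "images_of B R t (map (\<lambda>s. zip (rev t) (rev s)) (rev (qs ! i)))"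
        using images i that(2) by simp
      show "map (\<lambda>s. zip (rev t) (rev s)) (rev (qs ! i)) \<in> set (answers rs qs)"
        unfolding set_answers using i that(2) by auto
    qed
  qed
qed (fact k A B)+

lemma duplicator_wins_iff:
  assumes "cover_game k \<sigma> A B (answers rs qs)"
    and us: "listing us (universe A)" and vs: "listing vs (universe B)"
  shows "duplicator_wins k (fold parse (enc_nats xs @ enc_structure us rs @ enc_structure vs qs) start_state)
    \<longleftrightarrow> (\<exists>H. winning_strategy k \<sigma> A B H)"
proof -
  interpret cover_game k \<sigma> A B "answers rs qs" by fact
  let ?P = "pairings (rels_tree rs) (rels_tree qs)"
  have "(\<lambda>g. set (ls g)) ` set (ls (groups k ?P)) =
      (`) config_tree ` set ` set (choices k (answers rs qs))"
    by (simp add: pairings_rels_tree groups_config_tree image_image)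
  then have final: "(\<forall>grp\<in>set (ls (final_groups k ?P)). grp \<noteq> Leaf) \<longleftrightarrow>
      (\<exists>X. stable agree (set ` set (choices k (answers rs qs))) X)"
    unfolding final_groups_nonempty_iff
    by (simp only: stable_image[where R' = consistent and f = config_tree, OF consistent_config_tree])
  have empty: "tuple_tree us = Leaf \<longleftrightarrow> universe A = {}" "tuple_tree vs = Leaf \<longleftrightarrow> universe B = {}"
    using us vs by (auto simp: tuple_tree_def listing_def)
  show ?thesis
    unfolding winning_strategy_iff_stable parse_pair duplicator_wins_def parser_state_def
    by (simp add: final empty)
qed

theorem theorem4:
  fixes k :: nat
  assumes "k \<ge> 1"
  shows "poly_time_decidable
           {(\<sigma> :: nat signature, A :: (nat, nat) rel_structure, B :: (nat, nat) rel_structure).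
              finite_structure \<sigma> A \<and> finite_structure \<sigma> B}
           pair_codes
           (\<lambda>(\<sigma>, A, B). \<exists>H. winning_strategy k \<sigma> A B H)"
proof (rule poly_time_decidable_by_fold)
  show "feasible (parse a)" for a by (rule feasible_parse)
  show "feasible_pred (duplicator_wins k)" by (rule feasible_duplicator_wins)
  show "tsize (fold parse w start_state) \<le> poly [:13, 6:] (length w)" for w by (rule tsize_parse)
  fix x :: "nat signature \<times> (nat, nat) rel_structure \<times> (nat, nat) rel_structure" and w
  assume "x \<in> {(\<sigma>, A, B). finite_structure \<sigma> A \<and> finite_structure \<sigma> B}" and w: "w \<in> pair_codes x"
  then obtain \<sigma> A B where x: "x = (\<sigma>, A, B)" and A: "finite_structure \<sigma> A" and B: "finite_structure \<sigma> B"
    by auto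
  obtain ss us rs vs qs where code: "w = enc_nats (map (arity \<sigma>) ss) @ enc_structure us rs @ enc_structure vs qs"
    and ss: "listing ss (symbols \<sigma>)"
    and us: "listing us (universe A)" and rs: "list_all2 (\<lambda>r R. listing r (rel A R)) rs ss"
    and vs: "listing vs (universe B)" and qs: "list_all2 (\<lambda>r R. listing r (rel B R)) qs ss"
    using w unfolding x pair_codes_def structure_codes_def by auto
  have "set w \<subseteq> {1..<7}"
    unfolding code using set_enc_nats set_enc_structure by simp
  moreover have "duplicator_wins k (fold parse w start_state) \<longleftrightarrow> (\<exists>H. winning_strategy k \<sigma> A B H)"
    unfolding code using cover_game_answers[OF assms A B ss rs qs] us vs by (rule duplicator_wins_iff)
  ultimately show "set w \<subseteq> {1..<7} \<and> (duplicator_wins k (fold parse w start_state) \<longleftrightarrow>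
      (case x of (\<sigma>, A, B) \<Rightarrow> \<exists>H. winning_strategy k \<sigma> A B H))"
    by (simp add: x)
qed

end
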